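(* Let $G$ be a finitely generated recursively presented group. If $G$ admits a normally aperiodic effectively closed subshift, then $G$ has decidable word problem.
   Context: Let $G$ be a finitely generated group given as a quotient $G=\mathbb{F}_p/R$ of the free group $\mathbb{F}_p$ on $p$ generators, with quotient map $\phi:\mathbb{F}_p\to G$; $\lambda$ denotes the identity. $G$ is recursively presented, equivalently has recognizable word problem, if $\{g\in\mathbb{F}_p:\phi(g)=\lambda\}$ is recursively enumerable; it has decidable word problem if this set is recursive. Let $A$ be a finite alphabet. A word is a map $w$ from a finite subset of $\mathbb{F}_p$ to $A$. A configuration $x\in A^G$ disagrees with $w$ if there is $g$ in the domain of $w$ with $x_{\phi(g)}\neq w_g$. For a set $L$ of words, $S_L^G\subseteq A^G$ is the set of all configurations that disagree with every word of $L$. A closed set $S\subseteq A^G$ (prodiscrete topology) is effectively closed if $S=S_L^G$ for some recursively enumerable set of words $L$. $G$ acts on $A^G$ by $(gx)_h=x_{g^{-1}h}$. A closed set $X\subseteq A^G$ is a subshift if $gx\in X$ for all $x\in X$, $g\in G$; an effectively closed subshift is a subshift that is effectively closed. Let $Stab(x)=\{g\in G: gx=x\}$. A subshift $X$ is normally aperiodic if it is nonempty and for every $x\in X$ the subgroup $\bigcap_{h\in G}Stab(hx)$ is finite. "$G$ admits" such a subshift means one exists over some finite alphabet $A$. *)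

theory Defs
  imports
    "HOL-Library.Nat_Bijection"
    "HOL-Algebra.Group_Action"
    "HOL-Algebra.Elementary_Groups"
    "HOL-Analysis.Function_Topology"
begin

section \<open>Computability on the natural numbers\<close>

text \<open>
  Partial recursive functions are presented as unary functions, several arguments being passed
  through the pairing function \<^const>\<open>prod_encode\<close>; \<^const>\<open>None\<close> stands for an undefined value.
\<close>

definition pairing :: "(nat \<Rightarrow> nat option) \<Rightarrow> (nat \<Rightarrow> nat option) \<Rightarrow> nat \<Rightarrow> nat option" where
  "pairing f g = (\<lambda>n. Option.bind (f n) (\<lambda>a. Option.bind (g n) (\<lambda>b. Some (prod_encode (a, b)))))"

text \<open>
  Primitive recursion: on the argument \<open>(a, k)\<close> the value is given by \<open>h(a, 0) = f(a)\<close> and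
  \<open>h(a, k + 1) = g(a, (k, h(a, k)))\<close>.
\<close>

definition prim_recursion :: "(nat \<Rightarrow> nat option) \<Rightarrow> (nat \<Rightarrow> nat option) \<Rightarrow> nat \<Rightarrow> nat option" where
  "prim_recursion f g = (\<lambda>n. case prod_decode n of (a, k) \<Rightarrow>
     rec_nat (f a) (\<lambda>i r. Option.bind r (\<lambda>v. g (prod_encode (a, prod_encode (i, v))))) k)"

text \<open>
  Unbounded search: on the argument \<open>a\<close> the value is the least \<open>n\<close> with \<open>f(a, n) = 0\<close>, provided
  that \<open>f(a, m)\<close> is defined for all \<open>m < n\<close>.
\<close>

definition minimization :: "(nat \<Rightarrow> nat option) \<Rightarrow> nat \<Rightarrow> nat option" where
  "minimization f = (\<lambda>a.
     let P = (\<lambda>n. f (prod_encode (a, n)) = Some 0 \<and> (\<forall>m<n. f (prod_encode (a, m)) \<noteq> None))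
     in if \<exists>n. P n then Some (LEAST n. P n) else None)"

inductive partial_recursive :: "(nat \<Rightarrow> nat option) \<Rightarrow> bool" where
  zero: "partial_recursive (\<lambda>_. Some 0)"
| succ: "partial_recursive (\<lambda>n. Some (Suc n))"
| left: "partial_recursive (\<lambda>n. Some (fst (prod_decode n)))"
| right: "partial_recursive (\<lambda>n. Some (snd (prod_decode n)))"
| pairing: "partial_recursive f \<Longrightarrow> partial_recursive g \<Longrightarrow> partial_recursive (pairing f g)"
| comp: "partial_recursive f \<Longrightarrow> partial_recursive g \<Longrightarrow> partial_recursive (\<lambda>n. Option.bind (g n) f)"
| prim_recursion:
    "partial_recursive f \<Longrightarrow> partial_recursive g \<Longrightarrow> partial_recursive (prim_recursion f g)"
| minimization: "partial_recursive f \<Longrightarrow> partial_recursive (minimization f)"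

definition recursively_enumerable :: "nat set \<Rightarrow> bool" where
  "recursively_enumerable S \<longleftrightarrow> (\<exists>f. partial_recursive f \<and> S = dom f)"

definition recursive :: "nat set \<Rightarrow> bool" where
  "recursive S \<longleftrightarrow> partial_recursive (\<lambda>n. Some (if n \<in> S then 1 else 0))"


section \<open>Free groups of finite rank\<close>

text \<open>
  The letter \<open>(i, False)\<close> is the \<open>i\<close>-th generator and \<open>(i, True)\<close> is its inverse. Elements of the
  free group are the reduced words; the product reduces the concatenation.
\<close>

type_synonym letter = "nat \<times> bool"

definition inv_letter :: "letter \<Rightarrow> letter" where
  "inv_letter a = (fst a, \<not> snd a)"

abbreviation reduced :: "letter list \<Rightarrow> bool" where
  "reduced \<equiv> successively (\<lambda>a b. b \<noteq> inv_letter a)"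

fun cons_reduce :: "letter \<Rightarrow> letter list \<Rightarrow> letter list" where
  "cons_reduce a [] = [a]"
| "cons_reduce a (b # w) = (if b = inv_letter a then w else a # b # w)"

definition reduce :: "letter list \<Rightarrow> letter list" where
  "reduce w = foldr cons_reduce w []"

definition free_group :: "nat \<Rightarrow> letter list monoid" where
  "free_group p =
     \<lparr>carrier = {w. reduced w \<and> fst ` set w \<subseteq> {..<p}},
      mult = (\<lambda>u v. reduce (u @ v)),
      one = []\<rparr>"

lemma inv_letter_inv_letter [simp]: "inv_letter (inv_letter a) = a"
  by (simp add: inv_letter_def)

lemma reduced_cons_reduce: "reduced w \<Longrightarrow> reduced (cons_reduce a w)"
  by (cases w rule: list.exhaust) (auto simp: successively_Cons)

lemma reduced_foldr: "reduced v \<Longrightarrow> reduced (foldr cons_reduce u v)"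
  by (induction u) (auto intro: reduced_cons_reduce)

lemma reduced_reduce: "reduced (reduce u)"
  by (simp add: reduce_def reduced_foldr)

lemma cons_reduce_inverse: "reduced w \<Longrightarrow> cons_reduce (inv_letter a) (cons_reduce a w) = w"
proof (cases w)
  case (Cons b v)
  assume "reduced w"
  with Cons show ?thesis by (cases v) auto
qed simp

lemma reduce_reduced: "reduced w \<Longrightarrow> reduce w = w"
  unfolding reduce_def
proof (induction w)
  case (Cons a w)
  then show ?case by (cases w) auto
qed simp

lemma foldr_cons_reduce:
  assumes "reduced v"
  shows "foldr cons_reduce (cons_reduce a u) v = cons_reduce a (foldr cons_reduce u v)"
proof (cases u)
  case (Cons b w)
  have "reduced (foldr cons_reduce w v)" using assms by (rule reduced_foldr)
  from cons_reduce_inverse[OF this, of "inv_letter a"] Cons show ?thesis by simp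
qed simp

lemma foldr_reduce:
  assumes "reduced v"
  shows "foldr cons_reduce (reduce u) v = foldr cons_reduce u v"
  unfolding reduce_def by (induction u) (simp_all add: foldr_cons_reduce assms)

lemma reduce_append: "reduce (u @ v) = foldr cons_reduce u (reduce v)"
  by (simp add: reduce_def)

lemma fst_set_reduce: "fst ` set (reduce u) \<subseteq> fst ` set u"
proof -
  have *: "set (cons_reduce a w) \<subseteq> insert a (set w)" for a w
    by (cases w) auto
  have "set (reduce u) \<subseteq> set u"
    unfolding reduce_def by (induction u) (use * in fastforce)+
  then show ?thesis by blast
qed

lemma foldr_cons_reduce_inverse: "reduced x \<Longrightarrow> foldr cons_reduce (rev (map inv_letter x)) x = []"
proof (induction x)
  case (Cons a w)
  then show ?case by (cases w) auto
qed simp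

lemma reduced_inverse: "reduced x \<Longrightarrow> reduced (rev (map inv_letter x))"
proof (induction x rule: induct_list012)
  case (3 a b w)
  then show ?case
    by (auto simp: successively_append_iff)
qed auto

theorem group_free_group: "group (free_group p)"
proof (rule groupI)
  fix x y assume "x \<in> carrier (free_group p)" "y \<in> carrier (free_group p)"
  then have "reduced (reduce (x @ y)) \<and> fst ` set (reduce (x @ y)) \<subseteq> {..<p}"
    by (intro conjI reduced_reduce subset_trans[OF fst_set_reduce])
      (simp add: free_group_def image_Un)
  then show "x \<otimes>\<^bsub>free_group p\<^esub> y \<in> carrier (free_group p)"
    by (simp add: free_group_def)
next
  show "\<one>\<^bsub>free_group p\<^esub> \<in> carrier (free_group p)"
    by (simp add: free_group_def)
next
  fix x y z
  assume "z \<in> carrier (free_group p)"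
  then have z: "reduced z"
    by (simp add: free_group_def)
  have "reduce (reduce (x @ y) @ z) = foldr cons_reduce (reduce (x @ y)) z"
    by (simp only: reduce_append reduce_reduced[OF z])
  also have "\<dots> = foldr cons_reduce (x @ y) z"
    using z by (rule foldr_reduce)
  also have "\<dots> = foldr cons_reduce x (reduce (y @ z))"
    by (simp only: reduce_append reduce_reduced[OF z] foldr_append o_apply)
  also have "\<dots> = reduce (x @ reduce (y @ z))"
    by (simp only: reduce_append[of x] reduce_reduced[OF reduced_reduce])
  finally have "reduce (reduce (x @ y) @ z) = reduce (x @ reduce (y @ z))" .
  then show "x \<otimes>\<^bsub>free_group p\<^esub> y \<otimes>\<^bsub>free_group p\<^esub> z = x \<otimes>\<^bsub>free_group p\<^esub> (y \<otimes>\<^bsub>free_group p\<^esub> z)"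
    by (simp add: free_group_def)
next
  fix x assume "x \<in> carrier (free_group p)"
  then show "\<one>\<^bsub>free_group p\<^esub> \<otimes>\<^bsub>free_group p\<^esub> x = x"
    by (simp add: free_group_def reduce_reduced)
next
  fix x assume x: "x \<in> carrier (free_group p)"
  let ?y = "rev (map inv_letter x)"
  have "fst ` set ?y = fst ` set x"
    by (simp add: inv_letter_def image_image)
  then have "?y \<in> carrier (free_group p)"
    using x reduced_inverse[of x] by (simp add: free_group_def del: set_rev set_map)
  moreover have "?y \<otimes>\<^bsub>free_group p\<^esub> x = \<one>\<^bsub>free_group p\<^esub>"
    using x by (simp add: free_group_def reduce_append reduce_reduced foldr_cons_reduce_inverse)
  ultimately show "\<exists>y\<in>carrier (free_group p). y \<otimes>\<^bsub>free_group p\<^esub> x = \<one>\<^bsub>free_group p\<^esub>"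
    by blast
qed


section \<open>The word problem\<close>

definition letter_code :: "letter \<Rightarrow> nat" where
  "letter_code a = 2 * fst a + of_bool (snd a)"

definition word_code :: "letter list \<Rightarrow> nat" where
  "word_code w = list_encode (map letter_code w)"

text \<open>
  Below, a group \<open>G\<close> generated by \<open>p\<close> elements is given by an epimorphism \<open>\<phi>\<close> from the free
  group of rank \<open>p\<close> onto \<open>G\<close>.
\<close>

definition recursively_presented ::
    "nat \<Rightarrow> ('g, 'm) monoid_scheme \<Rightarrow> (letter list \<Rightarrow> 'g) \<Rightarrow> bool" where
  "recursively_presented p G \<phi> \<longleftrightarrow>
     recursively_enumerable (word_code ` kernel (free_group p) G \<phi>)"

definition decidable_word_problem ::
    "nat \<Rightarrow> ('g, 'm) monoid_scheme \<Rightarrow> (letter list \<Rightarrow> 'g) \<Rightarrow> bool" where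
  "decidable_word_problem p G \<phi> \<longleftrightarrow> recursive (word_code ` kernel (free_group p) G \<phi>)"


section \<open>Configurations, patterns and effectively closed sets\<close>

text \<open>
  \<open>A\<close> is the alphabet. Configurations are functions on \<open>carrier G\<close>, extended by
  \<^const>\<open>undefined\<close>. Patterns are words in the sense of symbolic dynamics: maps from
  a finite subset of the free group to \<open>A\<close>.
\<close>

definition configurations :: "('g, 'm) monoid_scheme \<Rightarrow> 'a set \<Rightarrow> ('g \<Rightarrow> 'a) set" where
  "configurations G A = carrier G \<rightarrow>\<^sub>E A"

definition patterns :: "nat \<Rightarrow> 'a set \<Rightarrow> (letter list \<Rightarrow> 'a option) set" where
  "patterns p A = {w. finite (dom w) \<and> dom w \<subseteq> carrier (free_group p) \<and> ran w \<subseteq> A}"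

definition disagrees :: "(letter list \<Rightarrow> 'g) \<Rightarrow> ('g \<Rightarrow> 'a) \<Rightarrow> (letter list \<Rightarrow> 'a option) \<Rightarrow> bool" where
  "disagrees \<phi> x w \<longleftrightarrow> (\<exists>g\<in>dom w. w g \<noteq> Some (x (\<phi> g)))"

definition avoiding_configurations ::
    "('g, 'm) monoid_scheme \<Rightarrow> (letter list \<Rightarrow> 'g) \<Rightarrow> 'a set \<Rightarrow> (letter list \<Rightarrow> 'a option) set
      \<Rightarrow> ('g \<Rightarrow> 'a) set" where
  "avoiding_configurations G \<phi> A L = {x \<in> configurations G A. \<forall>w\<in>L. disagrees \<phi> x w}"

text \<open>
  A pattern is coded by the canonical index of its graph, the letters of the alphabet being
  numbered by \<open>e\<close>. For a finite alphabet any two numberings differ by a permutation with finite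
  support, so enumerability of a set of patterns does not depend on the numbering.
\<close>

definition pattern_code :: "('a \<Rightarrow> nat) \<Rightarrow> (letter list \<Rightarrow> 'a option) \<Rightarrow> nat" where
  "pattern_code e w = set_encode ((\<lambda>g. prod_encode (word_code g, e (the (w g)))) ` dom w)"

definition recursively_enumerable_patterns ::
    "'a set \<Rightarrow> (letter list \<Rightarrow> 'a option) set \<Rightarrow> bool" where
  "recursively_enumerable_patterns A L \<longleftrightarrow>
     (\<exists>e. inj_on e A \<and> recursively_enumerable (pattern_code e ` L))"

definition prodiscrete :: "('g, 'm) monoid_scheme \<Rightarrow> 'a set \<Rightarrow> ('g \<Rightarrow> 'a) topology" where
  "prodiscrete G A = product_topology (\<lambda>_. discrete_topology A) (carrier G)"

definition effectively_closed ::
    "nat \<Rightarrow> ('g, 'm) monoid_scheme \<Rightarrow> (letter list \<Rightarrow> 'g) \<Rightarrow> 'a set \<Rightarrow> ('g \<Rightarrow> 'a) set \<Rightarrow> bool" where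
  "effectively_closed p G \<phi> A S \<longleftrightarrow>
     closedin (prodiscrete G A) S \<and>
     (\<exists>L \<subseteq> patterns p A. recursively_enumerable_patterns A L \<and> S = avoiding_configurations G \<phi> A L)"


section \<open>Subshifts\<close>

definition shift :: "('g, 'm) monoid_scheme \<Rightarrow> 'g \<Rightarrow> ('g \<Rightarrow> 'a) \<Rightarrow> 'g \<Rightarrow> 'a" where
  "shift G g x = (\<lambda>h\<in>carrier G. x (inv\<^bsub>G\<^esub> g \<otimes>\<^bsub>G\<^esub> h))"

definition subshift :: "('g, 'm) monoid_scheme \<Rightarrow> 'a set \<Rightarrow> ('g \<Rightarrow> 'a) set \<Rightarrow> bool" where
  "subshift G A X \<longleftrightarrow>
     closedin (prodiscrete G A) X \<and> (\<forall>x\<in>X. \<forall>g\<in>carrier G. shift G g x \<in> X)"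

definition normally_aperiodic :: "('g, 'm) monoid_scheme \<Rightarrow> ('g \<Rightarrow> 'a) set \<Rightarrow> bool" where
  "normally_aperiodic G X \<longleftrightarrow>
     X \<noteq> {} \<and>
     (\<forall>x\<in>X. finite (\<Inter>h\<in>carrier G. stabilizer G (shift G) (shift G h x)))"

end

theory Submission
  imports Defs
begin

text \<open>
  The relators form a recursively enumerable set, so by Post's theorem it is enough to enumerate the
  words that are not relators. If all the normal cores \<open>\<Inter>h. Stab(hx)\<close> were trivial, a word \<open>g\<close>
  would be a non-relator exactly if no \<open>x\<close> in the subshift is fixed by all conjugates of \<open>\<phi>(g)\<close>. The
  configurations of this kind are described by an effective list of finitary conditions: they avoid the
  enumerated patterns, are constant on the fibres of \<open>\<phi>\<close>, and do not change when \<open>g\<close> is inserted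
  in a position. By compactness, that there is none has a finite proof, which an exhaustive
  search finds.

  Finite normal cores are handled by non-uniform finite information. By Zorn's lemma and compactness
  there is a configuration \<open>x\<close> in the subshift whose normal core \<open>N\<close> is maximal. The configurations
  that are moreover fixed by \<open>N\<close> still form an effectively described set, since \<open>N\<close> is
  finite, and all of them have normal core exactly \<open>N\<close>. The search above now enumerates the words
  that do not represent elements of \<open>N\<close>. The words that represent one of the finitely many nontrivial
  elements of \<open>N\<close> are enumerated by means of the relators.

  The conditions are written as clauses of propositional logic whose variables say which letter stands
  at which word. Compactness is then \<open>unsatisfiable_iff\<close>, its effective version is
  \<open>semidecidable_unsatisfiable\<close>, and \<open>satisfiable_if_configuration\<close> and
  \<open>configuration_if_satisfiable\<close> translate between valuations and configurations. The maximality argument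
  is in \<open>decidable_relators\<close>.
\<close>


section \<open>Computable functions and decidable predicates\<close>

text \<open>
  Functions of several arguments are treated as functions of one argument \<open>q\<close> in which the arguments
  appear as projections of \<open>q\<close>. With the closure rules stated for an arbitrary dependence on the single
  argument, computability of a composite term is a matter of introduction rules.
\<close>

abbreviation pi1 :: "nat \<Rightarrow> nat" where "pi1 n \<equiv> fst (prod_decode n)"
abbreviation pi2 :: "nat \<Rightarrow> nat" where "pi2 n \<equiv> snd (prod_decode n)"
abbreviation pair :: "nat \<Rightarrow> nat \<Rightarrow> nat" where "pair a b \<equiv> prod_encode (a, b)"

definition computable :: "(nat \<Rightarrow> nat) \<Rightarrow> bool" where
  "computable f \<longleftrightarrow> partial_recursive (\<lambda>n. Some (f n))"

definition decidable :: "(nat \<Rightarrow> bool) \<Rightarrow> bool" where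
  "decidable P \<longleftrightarrow> computable (\<lambda>n. of_bool (P n))"

named_theorems computability

lemma computable_comp: "computable f \<Longrightarrow> computable g \<Longrightarrow> computable (\<lambda>n. f (g n))"
  unfolding computable_def by (drule (1) partial_recursive.comp) simp

lemma computable_pair [computability]:
  "computable f \<Longrightarrow> computable g \<Longrightarrow> computable (\<lambda>n. pair (f n) (g n))"
  unfolding computable_def by (drule (1) partial_recursive.pairing) (simp add: pairing_def)

lemma computable_pi1 [computability]: "computable f \<Longrightarrow> computable (\<lambda>n. pi1 (f n))"
  by (rule computable_comp[of pi1]) (simp_all add: computable_def partial_recursive.left)

lemma computable_pi2 [computability]: "computable f \<Longrightarrow> computable (\<lambda>n. pi2 (f n))"
  by (rule computable_comp[of pi2]) (simp_all add: computable_def partial_recursive.right)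

lemma computable_Suc [computability]: "computable f \<Longrightarrow> computable (\<lambda>n. Suc (f n))"
  by (rule computable_comp[of Suc]) (simp_all add: computable_def partial_recursive.succ)

lemma computable_id [computability]: "computable (\<lambda>n. n)"
proof -
  have "computable (\<lambda>n. pair (pi1 n) (pi2 n))"
    by (rule computable_pair) (simp_all add: computable_def partial_recursive.left partial_recursive.right)
  then show ?thesis by simp
qed

lemma computable_const [computability]: "computable (\<lambda>_. c)"
  by (induction c) (simp_all add: computable_def partial_recursive.zero computable_Suc[unfolded computable_def])

lemma computable_rec_nat [computability]:
  assumes "computable f" "computable (\<lambda>q. g (pi1 q) (pi1 (pi2 q)) (pi2 (pi2 q)))" "computable k"
  shows "computable (\<lambda>n. rec_nat (f n) (\<lambda>i r. g n i r) (k n))"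
proof -
  let ?G = "\<lambda>q. g (pi1 q) (pi1 (pi2 q)) (pi2 (pi2 q))"
  have "rec_nat (Some (f a)) (\<lambda>i r. Option.bind r (\<lambda>v. Some (?G (pair a (pair i v))))) m
      = Some (rec_nat (f a) (\<lambda>i r. g a i r) m)" for a m
    by (induction m) simp_all
  then have "prim_recursion (\<lambda>n. Some (f n)) (\<lambda>n. Some (?G n))
      = (\<lambda>n. Some (rec_nat (f (pi1 n)) (\<lambda>i r. g (pi1 n) i r) (pi2 n)))"
    by (simp add: prim_recursion_def split_beta)
  then have "computable (\<lambda>n. rec_nat (f (pi1 n)) (\<lambda>i r. g (pi1 n) i r) (pi2 n))"
    using partial_recursive.prim_recursion[OF assms(1,2)[unfolded computable_def]]
    by (simp add: computable_def)
  from computable_comp[OF this computable_pair[OF computable_id assms(3)]] show ?thesis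
    by simp
qed

text \<open>
  Since the search succeeds for every argument and the searched function is total, the proviso of
  definedness below the minimum disappears.
\<close>

lemma computable_Least:
  assumes "computable (\<lambda>q. g (pi1 q) (pi2 q))" "\<And>n. \<exists>m. g n m = 0"
  shows "computable (\<lambda>n. LEAST m. g n m = 0)"
proof -
  have "minimization (\<lambda>q. Some (g (pi1 q) (pi2 q))) = (\<lambda>n. Some (LEAST m. g n m = 0))"
    using assms(2) by (simp add: minimization_def)
  then show ?thesis
    using partial_recursive.minimization[OF assms(1)[unfolded computable_def]]
    by (simp add: computable_def)
qed

lemma computable_pred [computability]:
  assumes "computable f" shows "computable (\<lambda>n. f n - 1)"
proof -
  have "computable (\<lambda>n. rec_nat 0 (\<lambda>i r. i) (f n))"
    by (intro computability assms)
  moreover have "rec_nat 0 (\<lambda>i r. i) m = m - 1" for m by (cases m) simp_all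
  ultimately show ?thesis by simp
qed

lemma computable_add [computability]:
  assumes "computable f" "computable g" shows "computable (\<lambda>n. f n + g n)"
proof -
  have "computable (\<lambda>n. rec_nat (f n) (\<lambda>i r. Suc r) (g n))"
    by (intro computability assms)
  moreover have "rec_nat a (\<lambda>i r. Suc r) m = a + m" for a m by (induction m) simp_all
  ultimately show ?thesis by simp
qed

lemma computable_diff [computability]:
  assumes "computable f" "computable g" shows "computable (\<lambda>n. f n - g n)"
proof -
  have "computable (\<lambda>n. rec_nat (f n) (\<lambda>i r. r - 1) (g n))"
    by (intro computability assms)
  moreover have "rec_nat a (\<lambda>i r. r - 1) m = a - m" for a m by (induction m) simp_all
  ultimately show ?thesis by simp
qed

lemma computable_if [computability]:
  assumes "decidable P" "computable f" "computable g"
  shows "computable (\<lambda>n. if P n then f n else g n)"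
proof -
  have "computable (\<lambda>n. rec_nat (g n) (\<lambda>i r. f n) (of_bool (P n)))"
    by (intro computability assms assms(1)[unfolded decidable_def]
        computable_comp[OF assms(2) computable_pi1[OF computable_id]])
  moreover have "rec_nat (g n) (\<lambda>i r. f n) (of_bool (P n)) = (if P n then f n else g n)" for n
    by simp
  ultimately show ?thesis by simp
qed

lemma computable_of_bool [computability]: "decidable P \<Longrightarrow> computable (\<lambda>n. of_bool (P n))"
  by (simp add: decidable_def)

lemma decidable_le [computability]:
  assumes "computable f" "computable g" shows "decidable (\<lambda>n. f n \<le> g n)"
proof -
  have "computable (\<lambda>n. 1 - (f n - g n))" by (intro computability assms)
  moreover have "1 - (f n - g n) = of_bool (f n \<le> g n)" for n by auto
  ultimately show ?thesis by (simp add: decidable_def)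
qed

lemma decidable_less [computability]:
  assumes "computable f" "computable g" shows "decidable (\<lambda>n. f n < g n)"
  unfolding Suc_le_eq[symmetric] by (intro decidable_le computable_Suc assms)

lemma decidable_not [computability]:
  assumes "decidable P" shows "decidable (\<lambda>n. \<not> P n)"
proof -
  have "computable (\<lambda>n. if P n then 0 else 1)" by (intro computability assms)
  moreover have "(if P n then 0 else 1) = (of_bool (\<not> P n) :: nat)" for n by simp
  ultimately show ?thesis by (simp add: decidable_def)
qed

lemma decidable_conj [computability]:
  assumes "decidable P" "decidable Q" shows "decidable (\<lambda>n. P n \<and> Q n)"
proof -
  have "computable (\<lambda>n. if P n then of_bool (Q n) else 0)" by (intro computability assms)
  moreover have "(if P n then of_bool (Q n) else 0) = (of_bool (P n \<and> Q n) :: nat)" for n by simp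
  ultimately show ?thesis by (simp add: decidable_def)
qed

lemma decidable_disj [computability]:
  assumes "decidable P" "decidable Q" shows "decidable (\<lambda>n. P n \<or> Q n)"
proof -
  have "decidable (\<lambda>n. \<not> (\<not> P n \<and> \<not> Q n))" by (intro decidable_not decidable_conj assms)
  then show ?thesis by simp
qed

lemma decidable_imp [computability]:
  assumes "decidable P" "decidable Q" shows "decidable (\<lambda>n. P n \<longrightarrow> Q n)"
  unfolding imp_conv_disj by (intro decidable_not decidable_disj assms)

lemma decidable_eq [computability]:
  assumes "computable f" "computable g" shows "decidable (\<lambda>n. f n = g n)"
  unfolding eq_iff by (intro decidable_conj decidable_le assms)

lemma decidable_bounded_all [computability]:
  assumes "decidable (\<lambda>q. P (pi1 q) (pi2 q))" "computable b"
  shows "decidable (\<lambda>n. \<forall>i<b n. P n i)"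
proof -
  have *: "computable (\<lambda>q. of_bool (P (pi1 q) (pi1 (pi2 q))))"
    using computable_comp[OF computable_of_bool[OF assms(1)], of "\<lambda>q. pair (pi1 q) (pi1 (pi2 q))"]
    by (simp add: computability)
  have "computable (\<lambda>n. rec_nat 1 (\<lambda>i r. if r = 0 then 0 else of_bool (P n i)) (b n))"
    by (intro computability assms *)
  moreover have "rec_nat 1 (\<lambda>i r. if r = 0 then 0 else of_bool (P n i)) m
      = (of_bool (\<forall>i<m. P n i) :: nat)" for n m
    by (induction m) (auto simp: less_Suc_eq)
  ultimately show ?thesis by (simp add: decidable_def)
qed

lemma decidable_bounded_ex [computability]:
  assumes "decidable (\<lambda>q. P (pi1 q) (pi2 q))" "computable b"
  shows "decidable (\<lambda>n. \<exists>i<b n. P n i)"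
proof -
  have "decidable (\<lambda>n. \<not> (\<forall>i<b n. \<not> P n i))"
    by (intro decidable_not decidable_bounded_all assms)
  then show ?thesis by simp
qed

lemma decidable_comp: "decidable P \<Longrightarrow> computable f \<Longrightarrow> decidable (\<lambda>n. P (f n))"
  unfolding decidable_def by (rule computable_comp)

lemma computable_comp2:
  "computable (\<lambda>q. F (pi1 q) (pi2 q)) \<Longrightarrow> computable f \<Longrightarrow> computable g \<Longrightarrow> computable (\<lambda>n. F (f n) (g n))"
  using computable_comp[of "\<lambda>q. F (pi1 q) (pi2 q)" "\<lambda>n. pair (f n) (g n)"]
  by (simp add: computable_pair)

lemma decidable_comp2:
  "decidable (\<lambda>q. P (pi1 q) (pi2 q)) \<Longrightarrow> computable f \<Longrightarrow> computable g \<Longrightarrow> decidable (\<lambda>n. P (f n) (g n))"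
  unfolding decidable_def by (rule computable_comp2)

lemma decidable_odd [computability]:
  assumes "computable f" shows "decidable (\<lambda>n. odd (f n))"
proof -
  have "computable (\<lambda>n. rec_nat 0 (\<lambda>i r. 1 - r) (f n))" by (intro computability assms)
  moreover have "rec_nat 0 (\<lambda>i r. 1 - r) m = (of_bool (odd m) :: nat)" for m
    by (induction m) auto
  ultimately show ?thesis by (simp add: decidable_def)
qed

lemma computable_half [computability]:
  assumes "computable f" shows "computable (\<lambda>n. f n div 2)"
proof -
  have "computable (\<lambda>n. rec_nat 0 (\<lambda>i r. if odd i then Suc r else r) (f n))"
    by (intro computability assms)
  moreover have "rec_nat 0 (\<lambda>i r. if odd i then Suc r else r) m = m div 2" for m :: nat
    by (induction m) auto
  ultimately show ?thesis by simp
qed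

lemma computable_power2 [computability]:
  assumes "computable f" shows "computable (\<lambda>n. 2 ^ f n)"
proof -
  have "computable (\<lambda>n. rec_nat 1 (\<lambda>i r. r + r) (f n))" by (intro computability assms)
  moreover have "rec_nat 1 (\<lambda>i r. r + r) m = (2 ^ m :: nat)" for m by (induction m) auto
  ultimately show ?thesis by simp
qed

text \<open>
  The number \<open>m\<close> belongs to the finite set with canonical index \<open>x\<close> iff the binary digit of \<open>x\<close> at
  position \<open>m\<close> is \<open>1\<close>; the digit is reached by halving \<open>m\<close> times.
\<close>

lemma decidable_mem_set_decode [computability]:
  assumes "computable f" "computable g" shows "decidable (\<lambda>n. f n \<in> set_decode (g n))"
proof -
  have "decidable (\<lambda>n. odd (rec_nat (g n) (\<lambda>i r. r div 2) (f n)))"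
    by (intro computability assms)
  moreover have "rec_nat x (\<lambda>i r. r div 2) m = x div 2 ^ m" for x m :: nat
    by (induction m) (simp_all add: power_Suc2 div_mult2_eq del: power_Suc)
  ultimately show ?thesis by (simp add: set_decode_def)
qed


section \<open>Semidecidable predicates\<close>

text \<open>
  The projection form of recursive enumerability. In this form closure under existential quantification
  and conjunction needs only the pairing function, where domains of partial functions would require
  running several computations in parallel.
\<close>

definition semidecidable :: "(nat \<Rightarrow> bool) \<Rightarrow> bool" where
  "semidecidable P \<longleftrightarrow> (\<exists>R. decidable (\<lambda>q. R (pi1 q) (pi2 q)) \<and> (\<forall>n. P n \<longleftrightarrow> (\<exists>m. R n m)))"

lemma semidecidableI:
  "decidable (\<lambda>q. R (pi1 q) (pi2 q)) \<Longrightarrow> (\<And>n. P n \<longleftrightarrow> (\<exists>m. R n m)) \<Longrightarrow> semidecidable P"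
  unfolding semidecidable_def by blast

lemma semidecidableE:
  assumes "semidecidable P"
  obtains R where "decidable (\<lambda>q. R (pi1 q) (pi2 q))" "\<And>n. P n \<longleftrightarrow> (\<exists>m. R n m)"
  using assms unfolding semidecidable_def by blast

lemma semidecidable_comp:
  assumes "semidecidable P" "computable f" shows "semidecidable (\<lambda>n. P (f n))"
proof -
  from assms(1) obtain R where R: "decidable (\<lambda>q. R (pi1 q) (pi2 q))" "\<And>n. P n \<longleftrightarrow> (\<exists>m. R n m)"
    by (rule semidecidableE) blast
  show ?thesis
    by (rule semidecidableI[where R = "\<lambda>n m. R (f n) m"])
      (intro decidable_comp2[where P = R, OF R(1)] computability computable_comp[OF assms(2)], rule R(2))
qed

lemma semidecidable_decidable: "decidable P \<Longrightarrow> semidecidable P"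
  by (rule semidecidableI[where R = "\<lambda>n m. P n"])
    (simp_all add: decidable_comp[of P] computability)

lemma semidecidable_ex:
  assumes "semidecidable (\<lambda>q. P (pi1 q) (pi2 q))" shows "semidecidable (\<lambda>n. \<exists>i. P n i)"
proof -
  from assms obtain R where R: "decidable (\<lambda>q. R (pi1 q) (pi2 q))"
      "\<And>q. P (pi1 q) (pi2 q) \<longleftrightarrow> (\<exists>m. R q m)"
    by (rule semidecidableE) blast
  have "P n i \<longleftrightarrow> (\<exists>m. R (pair n i) m)" for n i using R(2)[of "pair n i"] by simp
  \<comment> \<open>A single number codes the value of the quantified variable together with its certificate.\<close>
  then have "(\<exists>i. P n i) \<longleftrightarrow> (\<exists>j. R (pair n (pi1 j)) (pi2 j))" for n
    by (metis fst_conv snd_conv prod_encode_inverse)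
  then show ?thesis
    by (rule semidecidableI[rotated]) (intro decidable_comp2[where P = R, OF R(1)] computability)
qed

lemma semidecidable_conj:
  assumes "semidecidable P" "semidecidable Q" shows "semidecidable (\<lambda>n. P n \<and> Q n)"
proof -
  from assms(1) obtain R where R: "decidable (\<lambda>q. R (pi1 q) (pi2 q))" "\<And>n. P n \<longleftrightarrow> (\<exists>m. R n m)"
    by (rule semidecidableE) blast
  from assms(2) obtain S where S: "decidable (\<lambda>q. S (pi1 q) (pi2 q))" "\<And>n. Q n \<longleftrightarrow> (\<exists>m. S n m)"
    by (rule semidecidableE) blast
  have "(P n \<and> Q n) \<longleftrightarrow> (\<exists>m. R n (pi1 m) \<and> S n (pi2 m))" for n
    unfolding R(2) S(2) by (metis fst_conv snd_conv prod_encode_inverse)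
  then show ?thesis
    by (rule semidecidableI[rotated])
      (intro decidable_comp2[where P = R, OF R(1)] decidable_comp2[where P = S, OF S(1)] computability)
qed

lemma semidecidable_disj:
  assumes "semidecidable P" "semidecidable Q" shows "semidecidable (\<lambda>n. P n \<or> Q n)"
proof -
  from assms(1) obtain R where R: "decidable (\<lambda>q. R (pi1 q) (pi2 q))" "\<And>n. P n \<longleftrightarrow> (\<exists>m. R n m)"
    by (rule semidecidableE) blast
  from assms(2) obtain S where S: "decidable (\<lambda>q. S (pi1 q) (pi2 q))" "\<And>n. Q n \<longleftrightarrow> (\<exists>m. S n m)"
    by (rule semidecidableE) blast
  show ?thesis
    by (rule semidecidableI[where R = "\<lambda>n m. R n m \<or> S n m"])
      (intro decidable_comp2[where P = R, OF R(1)] decidable_comp2[where P = S, OF S(1)] computability, auto simp: R(2) S(2))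
qed

text \<open>
  Collection for a bounded universal quantifier: finitely many monotone conditions that hold at some
  stage each hold at a common stage.
\<close>

lemma bounded_collection:
  fixes Q :: "nat \<Rightarrow> nat \<Rightarrow> bool"
  assumes "\<And>i s s'. Q i s \<Longrightarrow> s \<le> s' \<Longrightarrow> Q i s'" "\<forall>i<b. \<exists>s. Q i s"
  shows "\<exists>s. \<forall>i<b. Q i s"
  using assms(2)
proof (induction b)
  case (Suc b)
  then obtain s s' where "\<forall>i<b. Q i s" "Q b s'" by auto
  then have "\<forall>i<Suc b. Q i (max s s')"
    by (metis assms(1) less_Suc_eq max.cobounded1 max.cobounded2)
  then show ?case ..
qed simp

text \<open>
  By collection the witnesses for all \<open>i\<close> below the bound have a common bound, so a single number
  certifies the whole quantifier.
\<close>

lemma semidecidable_bounded_all: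
  assumes "semidecidable (\<lambda>q. P (pi1 q) (pi2 q))" "computable b"
  shows "semidecidable (\<lambda>n. \<forall>i<b n. P n i)"
proof -
  from assms(1) obtain R where R: "decidable (\<lambda>q. R (pi1 q) (pi2 q))"
      "\<And>q. P (pi1 q) (pi2 q) \<longleftrightarrow> (\<exists>m. R q m)"
    by (rule semidecidableE) blast
  have P: "P n i \<longleftrightarrow> (\<exists>m. R (pair n i) m)" for n i using R(2)[of "pair n i"] by simp
  have "(\<forall>i<b n. P n i) \<longleftrightarrow> (\<exists>s. \<forall>i<b n. \<exists>m<s. R (pair n i) m)" for n
  proof
    assume "\<forall>i<b n. P n i"
    then have "\<forall>i<b n. \<exists>s. \<exists>m<s. R (pair n i) m"
      unfolding P using lessI by blast
    then show "\<exists>s. \<forall>i<b n. \<exists>m<s. R (pair n i) m"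
      by (rule bounded_collection[rotated]) (meson order_less_le_trans)
  qed (auto simp: P)
  then show ?thesis
    by (rule semidecidableI[rotated])
      (intro decidable_comp2[where P = R, OF R(1)] computability computable_comp[OF assms(2)])
qed

lemma semidecidable_finite_all:
  assumes "finite V" "\<And>v. v \<in> V \<Longrightarrow> semidecidable (P v)"
  shows "semidecidable (\<lambda>n. \<forall>v\<in>V. P v n)"
  using assms
proof (induction V)
  case empty
  have "decidable (\<lambda>n. n = n)" by (intro computability)
  then show ?case by (simp add: semidecidable_decidable)
next
  case (insert v V)
  then show ?case by (simp add: semidecidable_conj)
qed

text \<open>
  Post's theorem: of a certificate for \<open>P n\<close> and a certificate for \<open>\<not> P n\<close> exactly one exists, and a
  search among both kinds ends.
\<close>

lemma decidable_by_complement: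
  assumes "semidecidable P" "semidecidable (\<lambda>n. \<not> P n)" shows "decidable P"
proof -
  from assms(1) obtain R where R: "decidable (\<lambda>q. R (pi1 q) (pi2 q))" "\<And>n. P n \<longleftrightarrow> (\<exists>m. R n m)"
    by (rule semidecidableE) blast
  from assms(2) obtain S where S: "decidable (\<lambda>q. S (pi1 q) (pi2 q))" "\<And>n. \<not> P n \<longleftrightarrow> (\<exists>m. S n m)"
    by (rule semidecidableE) blast
  let ?g = "\<lambda>n m. of_bool (\<not> (R n m \<or> S n m)) :: nat"
  have ex: "\<exists>m. ?g n m = 0" for n
  proof -
    have "\<exists>m. R n m \<or> S n m" using R(2)[of n] S(2)[of n] by blast
    then show ?thesis by simp
  qed
  have "decidable (\<lambda>n. R n (LEAST m. ?g n m = 0))"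
    by (intro decidable_comp2[where P = R, OF R(1)] computability computable_Least ex R(1) S(1))
  moreover have "R n (LEAST m. ?g n m = 0) \<longleftrightarrow> P n" for n
    using LeastI_ex[OF ex, of n] R(2)[of n] S(2)[of n] by auto
  ultimately show ?thesis by simp
qed


section \<open>Recursively enumerable sets are semidecidable\<close>

text \<open>
  \<open>F n s\<close> is the outcome of running \<open>f\<close> on \<open>n\<close> for \<open>s\<close> stages: \<open>0\<close> while there is no value yet, and
  \<open>Suc v\<close> once the value \<open>v\<close> has been found, from then on for ever.
\<close>

definition approximates :: "(nat \<Rightarrow> nat \<Rightarrow> nat) \<Rightarrow> (nat \<Rightarrow> nat option) \<Rightarrow> bool" where
  "approximates F f \<longleftrightarrow>
     (\<forall>n s s' v. F n s = Suc v \<longrightarrow> s \<le> s' \<longrightarrow> F n s' = Suc v) \<and>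
     (\<forall>n v. f n = Some v \<longleftrightarrow> (\<exists>s. F n s = Suc v))"

lemma approximates_mono: "approximates F f \<Longrightarrow> F n s = Suc v \<Longrightarrow> s \<le> s' \<Longrightarrow> F n s' = Suc v"
  unfolding approximates_def by blast

lemma approximates_iff: "approximates F f \<Longrightarrow> f n = Some v \<longleftrightarrow> (\<exists>s. F n s = Suc v)"
  unfolding approximates_def by blast

text \<open>
  Minimization in terms of values alone: all earlier values exist and are positive. In this form a stage
  at which the search is seen to end remains one, and it determines the result.
\<close>

lemma minimization_eq_Some:
  "minimization f n = Some v \<longleftrightarrow>
     f (pair n v) = Some 0 \<and> (\<forall>j<v. \<exists>y. f (pair n j) = Some (Suc y))"
proof -
  define P where "P = (\<lambda>v. f (pair n v) = Some 0 \<and> (\<forall>j<v. f (pair n j) \<noteq> None))"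
  have min: "minimization f n = (if \<exists>v. P v then Some (LEAST v. P v) else None)"
    unfolding minimization_def P_def Let_def ..
  have Q: "P v \<and> (\<forall>j<v. \<not> P j) \<longleftrightarrow>
     f (pair n v) = Some 0 \<and> (\<forall>j<v. \<exists>y. f (pair n j) = Some (Suc y))" (is "_ \<longleftrightarrow> ?Q")
  proof
    assume *: "P v \<and> (\<forall>j<v. \<not> P j)"
    have "\<exists>y. f (pair n j) = Some (Suc y)" if "j < v" for j
    proof -
      from * that obtain y where "f (pair n j) = Some y" unfolding P_def by blast
      moreover have "f (pair n j) \<noteq> Some 0" using * that less_trans unfolding P_def by blast
      ultimately show ?thesis by (cases y) auto
    qed
    with * show ?Q unfolding P_def by blast
  next
    assume ?Q then show "P v \<and> (\<forall>j<v. \<not> P j)" unfolding P_def by fastforce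
  qed
  have "minimization f n = Some v \<longleftrightarrow> P v \<and> (\<forall>j<v. \<not> P j)"
    unfolding min by (metis LeastI Least_equality linorder_not_le not_less_Least option.distinct(1) option.inject)
  with Q show ?thesis by simp
qed

text \<open>
  A bounded search written as a primitive recursion; uniqueness of the hit makes the outcome independent
  of the bound.
\<close>

lemma rec_nat_unique_search:
  assumes "\<And>i j. H i \<Longrightarrow> H j \<Longrightarrow> i = j"
  shows "rec_nat 0 (\<lambda>i r. if H i then Suc i else r) s = Suc v \<longleftrightarrow> v < s \<and> H v"
  by (induction s) (auto simp: less_Suc_eq dest: assms)

lemma prim_recursion_pair:
  "prim_recursion f g (pair a 0) = f a"
  "prim_recursion f g (pair a (Suc k)) =
     Option.bind (prim_recursion f g (pair a k)) (\<lambda>v. g (pair a (pair k v)))"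
  by (simp_all add: prim_recursion_def)

text \<open>
  The part of Kleene's normal form theorem that is needed to interleave computations. Each construction
  of partial recursive functions is imitated stage by stage; a convergent computation consults
  only finitely many values, so it is completed at one common stage.
\<close>

theorem stage_approximation:
  assumes "partial_recursive f"
  shows "\<exists>F. computable (\<lambda>q. F (pi1 q) (pi2 q)) \<and> approximates F f"
  using assms
proof induction
  case zero
  have "computable (\<lambda>q. Suc 0)" by (intro computability)
  then show ?case by (intro exI[of _ "\<lambda>n s. Suc 0"]) (auto simp: approximates_def)
next
  case succ
  have "computable (\<lambda>q. Suc (Suc (pi1 q)))" by (intro computability)
  then show ?case by (intro exI[of _ "\<lambda>n s. Suc (Suc n)"]) (auto simp: approximates_def)
next
  case left
  have "computable (\<lambda>q. Suc (pi1 (pi1 q)))" by (intro computability)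
  then show ?case by (intro exI[of _ "\<lambda>n s. Suc (pi1 n)"]) (auto simp: approximates_def)
next
  case right
  have "computable (\<lambda>q. Suc (pi2 (pi1 q)))" by (intro computability)
  then show ?case by (intro exI[of _ "\<lambda>n s. Suc (pi2 n)"]) (auto simp: approximates_def)
next
  case (pairing f g)
  then obtain F G where F: "computable (\<lambda>q. F (pi1 q) (pi2 q))" "approximates F f"
    and G: "computable (\<lambda>q. G (pi1 q) (pi2 q))" "approximates G g" by blast
  let ?H = "\<lambda>n s. if F n s = 0 \<or> G n s = 0 then 0 else Suc (pair (F n s - 1) (G n s - 1))"
  have H: "?H n s = Suc v \<longleftrightarrow> (\<exists>a b. F n s = Suc a \<and> G n s = Suc b \<and> v = pair a b)" for n s v
    by (cases "F n s"; cases "G n s") auto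
  have "computable (\<lambda>q. ?H (pi1 q) (pi2 q))"
    by (intro computability F(1) G(1))
  moreover have "approximates ?H (pairing f g)"
    unfolding approximates_def H
  proof (intro conjI allI impI)
    fix n v
    have "pairing f g n = Some v \<longleftrightarrow> (\<exists>a b. f n = Some a \<and> g n = Some b \<and> v = pair a b)"
      by (auto simp: pairing_def bind_eq_Some_conv)
    also have "\<dots> \<longleftrightarrow> (\<exists>s a b. F n s = Suc a \<and> G n s = Suc b \<and> v = pair a b)"
    proof
      assume "\<exists>a b. f n = Some a \<and> g n = Some b \<and> v = pair a b"
      then obtain a b s s' where "F n s = Suc a" "G n s' = Suc b" "v = pair a b"
        by (auto simp: approximates_iff[OF F(2)] approximates_iff[OF G(2)])
      then show "\<exists>s a b. F n s = Suc a \<and> G n s = Suc b \<and> v = pair a b"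
        by (metis approximates_mono[OF F(2)] approximates_mono[OF G(2)] max.cobounded1 max.cobounded2)
    qed (auto simp: approximates_iff[OF F(2)] approximates_iff[OF G(2)])
    finally show "pairing f g n = Some v \<longleftrightarrow> \<dots>" .
  qed (use approximates_mono[OF F(2)] approximates_mono[OF G(2)] in blast)
  ultimately show ?case by (intro exI conjI)
next
  case (comp f g)
  then obtain F G where F: "computable (\<lambda>q. F (pi1 q) (pi2 q))" "approximates F f"
    and G: "computable (\<lambda>q. G (pi1 q) (pi2 q))" "approximates G g" by blast
  let ?H = "\<lambda>n s. if G n s = 0 then 0 else F (G n s - 1) s"
  have H: "?H n s = Suc v \<longleftrightarrow> (\<exists>a. G n s = Suc a \<and> F a s = Suc v)" for n s v
    by (cases "G n s") auto
  have "computable (\<lambda>q. ?H (pi1 q) (pi2 q))"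
    by (intro computability computable_comp2[where F = F, OF F(1)] G(1))
  moreover have "approximates ?H (\<lambda>n. Option.bind (g n) f)"
    unfolding approximates_def H
  proof (intro conjI allI impI)
    fix n v
    have "Option.bind (g n) f = Some v \<longleftrightarrow> (\<exists>a. g n = Some a \<and> f a = Some v)"
      by (auto simp: bind_eq_Some_conv)
    also have "\<dots> \<longleftrightarrow> (\<exists>s a. G n s = Suc a \<and> F a s = Suc v)"
    proof
      assume "\<exists>a. g n = Some a \<and> f a = Some v"
      then obtain a s s' where "F a s = Suc v" "G n s' = Suc a"
        by (auto simp: approximates_iff[OF F(2)] approximates_iff[OF G(2)])
      then show "\<exists>s a. G n s = Suc a \<and> F a s = Suc v"
        by (metis approximates_mono[OF F(2)] approximates_mono[OF G(2)] max.cobounded1 max.cobounded2)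
    qed (auto simp: approximates_iff[OF F(2)] approximates_iff[OF G(2)])
    finally show "Option.bind (g n) f = Some v \<longleftrightarrow> \<dots>" .
  qed (use approximates_mono[OF F(2)] approximates_mono[OF G(2)] in blast)
  ultimately show ?case by (intro exI conjI)
next
  case (prim_recursion f g)
  then obtain F G where F: "computable (\<lambda>q. F (pi1 q) (pi2 q))" "approximates F f"
    and G: "computable (\<lambda>q. G (pi1 q) (pi2 q))" "approximates G g" by blast
  define h where "h a s k = rec_nat (F a s) (\<lambda>i r. if r = 0 then 0 else G (pair a (pair i (r - 1))) s) k"
    for a s k
  have h_0: "h a s 0 = F a s" for a s by (simp add: h_def)
  have h_Suc: "h a s (Suc k) = Suc v \<longleftrightarrow> (\<exists>y. h a s k = Suc y \<and> G (pair a (pair k y)) s = Suc v)"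
    for a s k v
    by (cases "h a s k") (auto simp: h_def)
  have mono: "h a s k = Suc v \<Longrightarrow> s \<le> s' \<Longrightarrow> h a s' k = Suc v" for a s s' k v
    by (induction k arbitrary: v)
      (auto simp: h_0 h_Suc intro: approximates_mono[OF F(2)] approximates_mono[OF G(2)])
  have iff: "prim_recursion f g (pair a k) = Some v \<longleftrightarrow> (\<exists>s. h a s k = Suc v)" for a k v
  proof (induction k arbitrary: v)
    case 0
    then show ?case by (simp add: prim_recursion_pair h_0 approximates_iff[OF F(2)])
  next
    case (Suc k)
    have "prim_recursion f g (pair a (Suc k)) = Some v \<longleftrightarrow>
        (\<exists>y s s'. h a s k = Suc y \<and> G (pair a (pair k y)) s' = Suc v)"
      by (auto simp: prim_recursion_pair bind_eq_Some_conv Suc approximates_iff[OF G(2)])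
    also have "\<dots> \<longleftrightarrow> (\<exists>s y. h a s k = Suc y \<and> G (pair a (pair k y)) s = Suc v)"
      by (metis approximates_mono[OF G(2)] mono max.cobounded1 max.cobounded2)
    finally show ?case by (simp add: h_Suc)
  qed
  have "computable (\<lambda>q. h (pi1 (pi1 q)) (pi2 q) (pi2 (pi1 q)))"
    unfolding h_def by (intro computability computable_comp2[where F = F, OF F(1)] computable_comp2[where F = G, OF G(1)])
  moreover have "approximates (\<lambda>n s. h (pi1 n) s (pi2 n)) (prim_recursion f g)"
    unfolding approximates_def
  proof (intro conjI allI impI)
    show "prim_recursion f g n = Some v \<longleftrightarrow> (\<exists>s. h (pi1 n) s (pi2 n) = Suc v)" for n v
      using iff[of "pi1 n" "pi2 n"] by simp
  qed (rule mono)
  ultimately show ?case by (intro exI conjI)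
next
  case (minimization f)
  then obtain F where F: "computable (\<lambda>q. F (pi1 q) (pi2 q))" "approximates F f" by blast
  \<comment> \<open>At stage \<open>s\<close> the search from \<open>n\<close> is known to end at \<open>m\<close>.\<close>
  define hit where "hit n s m \<longleftrightarrow> F (pair n m) s = 1 \<and> (\<forall>j<m. 1 < F (pair n j) s)" for n s m
  have hit_unique: "hit n s i \<Longrightarrow> hit n s j \<Longrightarrow> i = j" for n s i j
    unfolding hit_def by (metis less_irrefl linorder_neqE_nat)
  have gt: "1 < F n s \<longleftrightarrow> (\<exists>y. F n s = Suc (Suc y))" for n s
    by (cases "F n s"; cases "F n s - 1") auto
  have gt_mono: "1 < F i s \<Longrightarrow> s \<le> s' \<Longrightarrow> 1 < F i s'" for i s s'
    unfolding gt using approximates_mono[OF F(2)] by blast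
  have hit_mono: "hit n s' m" if "hit n s m" "s \<le> s'" for n s s' m
    using that approximates_mono[OF F(2), of "pair n m" s 0 s'] gt_mono unfolding hit_def by auto
  define H where "H n s = rec_nat 0 (\<lambda>i r. if hit n s i then Suc i else r) s" for n s
  have H: "H n s = Suc v \<longleftrightarrow> v < s \<and> hit n s v" for n s v
    unfolding H_def by (rule rec_nat_unique_search) (rule hit_unique)
  have "decidable (\<lambda>q. hit (pi1 (pi1 q)) (pi2 (pi1 q)) (pi1 (pi2 q)))"
    unfolding hit_def by (intro computability computable_comp2[where F = F, OF F(1)])
  then have "computable (\<lambda>q. H (pi1 q) (pi2 q))"
    unfolding H_def by (intro computability)
  moreover have "approximates H (minimization f)"
    unfolding approximates_def H
  proof (intro conjI allI impI)
    fix n v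
    have "minimization f n = Some v \<longleftrightarrow>
        (\<exists>s. F (pair n v) s = Suc 0) \<and> (\<forall>j<v. \<exists>s. 1 < F (pair n j) s)"
      by (simp only: minimization_eq_Some approximates_iff[OF F(2)] gt) blast
    also have "\<dots> \<longleftrightarrow> (\<exists>s. v < s \<and> hit n s v)"
    proof
      assume *: "(\<exists>s. F (pair n v) s = Suc 0) \<and> (\<forall>j<v. \<exists>s. 1 < F (pair n j) s)"
      have "\<exists>s. \<forall>j<v. 1 < F (pair n j) s"
        by (rule bounded_collection[OF _ conjunct2[OF *]]) (rule gt_mono)
      with * obtain s s' where s: "F (pair n v) s = Suc 0" "\<forall>j<v. 1 < F (pair n j) s'"
        by blast
      define t where "t = Suc (max v (max s s'))"
      have t: "v < t" "s \<le> t" "s' \<le> t" by (auto simp: t_def)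
      have "hit n t v"
        unfolding hit_def using approximates_mono[OF F(2) s(1) t(2)] gt_mono[OF _ t(3)] s(2) by simp
      with t show "\<exists>s. v < s \<and> hit n s v" by blast
    qed (auto simp: hit_def)
    finally show "minimization f n = Some v \<longleftrightarrow> (\<exists>s. v < s \<and> hit n s v)" .
  next
    fix n s s' v assume "v < s \<and> hit n s v" "s \<le> s'"
    then show "v < s'" "hit n s' v" using hit_mono by auto
  qed
  ultimately show ?case by (intro exI conjI)
qed

lemma semidecidable_recursively_enumerable:
  assumes "recursively_enumerable S" shows "semidecidable (\<lambda>n. n \<in> S)"
proof -
  from assms obtain f where f: "partial_recursive f" "S = dom f"
    unfolding recursively_enumerable_def by blast
  from stage_approximation[OF f(1)] obtain F
    where F: "computable (\<lambda>q. F (pi1 q) (pi2 q))" "approximates F f" by blast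
  show ?thesis
  proof (rule semidecidableI)
    show "decidable (\<lambda>q. F (pi1 q) (pi2 q) \<noteq> 0)" by (intro computability F(1))
    show "n \<in> S \<longleftrightarrow> (\<exists>s. F n s \<noteq> 0)" for n
      unfolding f(2) domIff not_None_eq approximates_iff[OF F(2)] by (auto simp: gr0_conv_Suc)
  qed
qed


section \<open>Recursion over coded lists\<close>

text \<open>
  The state is the pair of the code of the remaining list and the accumulated value. Idle steps are
  harmless once the list is exhausted, and the code of a list bounds its length, so the code itself can
  serve as the number of steps.
\<close>

lemma computable_fold:
  assumes "computable (\<lambda>q. f (pi1 q) (pi2 q))" "computable u" "computable w"
  shows "computable (\<lambda>n. fold f (list_decode (u n)) (w n))"
proof -
  let ?step = "\<lambda>s. if pi1 s = 0 then s else pair (pi2 (pi1 s - 1)) (f (pi1 (pi1 s - 1)) (pi2 s))"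
  have step: "?step (pair (list_encode (a # xs)) y) = pair (list_encode xs) (f a y)"
      "?step (pair (list_encode []) y) = pair (list_encode []) y" for a xs y
    by simp_all
  have run: "length xs \<le> k \<Longrightarrow>
      rec_nat (pair (list_encode xs) y) (\<lambda>_. ?step) k = pair 0 (fold f xs y)" for xs y k
  proof -
    have *: "rec_nat s (\<lambda>_. ?step) (Suc k) = rec_nat (?step s) (\<lambda>_. ?step) k" for s k
      by (induction k) simp_all
    have idle: "rec_nat (pair 0 y) (\<lambda>_. ?step) k = pair 0 y" for y k
      by (induction k) simp_all
    show "length xs \<le> k \<Longrightarrow> ?thesis"
    proof (induction k arbitrary: xs y)
      case (Suc k)
      show ?case
      proof (cases xs)
        case (Cons a xs')
        with Suc show ?thesis unfolding * Cons step by simp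
      qed (simp only: list_encode.simps idle fold.simps id_apply)
    qed simp
  qed
  have len: "length xs \<le> list_encode xs" for xs
    by (induction xs) (auto intro: order_trans[OF _ le_prod_encode_2])
  have "computable (\<lambda>n. pi2 (rec_nat (pair (u n) (w n)) (\<lambda>_ s. ?step s) (u n)))"
    by (intro computability computable_comp2[where F = f, OF assms(1)] assms(2,3))
  moreover have "pi2 (rec_nat (pair m y) (\<lambda>_. ?step) m) = fold f (list_decode m) y" for m y
    using run[OF len[of "list_decode m"], of y] by simp
  ultimately show ?thesis by simp
qed

lemma computable_foldr:
  assumes "computable (\<lambda>q. f (pi1 q) (pi2 q))" "computable u" "computable w"
  shows "computable (\<lambda>n. foldr f (list_decode (u n)) (w n))"
proof -
  have "fold (\<lambda>a y. Suc (pair a y)) xs (list_encode ys) = list_encode (rev xs @ ys)" for xs ys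
    by (induction xs arbitrary: ys) (simp_all flip: list_encode.simps(2))
  from this[where ys = "[]"] have rev: "fold (\<lambda>a y. Suc (pair a y)) xs 0 = list_encode (rev xs)" for xs
    by simp
  have "computable (\<lambda>n. fold f (list_decode (fold (\<lambda>a y. Suc (pair a y)) (list_decode (u n)) 0)) (w n))"
    by (intro computable_fold computability assms)
  then show ?thesis by (simp add: rev foldr_conv_fold)
qed


section \<open>Compactness of propositional logic\<close>

text \<open>
  Propositional variables are the natural numbers and a valuation is the set \<open>Z\<close> of the true ones. A
  clause is given by the canonical indices \<open>P\<close> and \<open>N\<close> of the sets of its positive and of its negative
  literals, and a predicate on pairs of indices is a set of clauses.
\<close>

definition satisfies :: "nat set \<Rightarrow> nat \<Rightarrow> nat \<Rightarrow> bool" where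
  "satisfies Z P N \<longleftrightarrow> set_decode P \<inter> Z \<noteq> {} \<or> \<not> set_decode N \<subseteq> Z"

definition satisfiable :: "(nat \<Rightarrow> nat \<Rightarrow> bool) \<Rightarrow> bool" where
  "satisfiable C \<longleftrightarrow> (\<exists>Z. \<forall>P N. C P N \<longrightarrow> satisfies Z P N)"

text \<open>
  The clause mentions only variables below \<open>M\<close> and is false under every valuation that agrees with \<open>S\<close>
  below \<open>M\<close>, where \<open>S\<close> is a set of variables below \<open>M\<close>.
\<close>

definition falsified_below :: "nat \<Rightarrow> nat set \<Rightarrow> nat \<Rightarrow> nat \<Rightarrow> bool" where
  "falsified_below M S P N \<longleftrightarrow> set_decode P \<subseteq> {..<M} - S \<and> set_decode N \<subseteq> S"

text \<open>
  Koenig's lemma for the binary tree whose nodes at level \<open>M\<close> are the subsets of \<open>{..<M}\<close>: the branch is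
  built by keeping the current node extendable to all higher levels.
\<close>

lemma koenig_subsets:
  fixes Q :: "nat \<Rightarrow> nat set \<Rightarrow> bool"
  assumes mono: "\<And>M M' S. Q M' S \<Longrightarrow> M \<le> M' \<Longrightarrow> Q M (S \<inter> {..<M})"
    and finite_levels: "\<And>M. \<exists>S\<subseteq>{..<M}. Q M S"
  shows "\<exists>Z. \<forall>M. Q M (Z \<inter> {..<M})"
proof -
  \<comment> \<open>A node is extendable if it has good descendants at all higher levels.\<close>
  define ext where "ext M S \<longleftrightarrow> (\<forall>M'\<ge>M. \<exists>S'. S' \<inter> {..<M} = S \<and> Q M' S')" for M S
  have ext_0: "ext 0 {}"
    unfolding ext_def using finite_levels by auto
  have ext_Suc: "ext (Suc M) (insert M S)" if e: "ext M S" "\<not> ext (Suc M) S" for M S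
    unfolding ext_def
  proof (intro allI impI)
    \<comment> \<open>Go beyond a level \<open>M1\<close> at which \<open>S\<close> without \<open>M\<close> has no good descendant left.\<close>
    fix M' assume "Suc M \<le> M'"
    obtain M1 where M1: "Suc M \<le> M1" "\<And>S'. S' \<inter> {..<Suc M} = S \<Longrightarrow> \<not> Q M1 S'"
      using e(2) unfolding ext_def by blast
    let ?K = "max M' M1"
    obtain S' where S': "S' \<inter> {..<M} = S" "Q ?K S'"
      using e(1) \<open>Suc M \<le> M'\<close> unfolding ext_def by (meson Suc_leD max.coboundedI1)
    have "M \<in> S'"
    proof (rule ccontr)
      assume "M \<notin> S'"
      then have "S' \<inter> {..<M1} \<inter> {..<Suc M} = S"
        using S'(1) M1(1) by (auto simp: less_Suc_eq)
      moreover have "Q M1 (S' \<inter> {..<M1})" using S'(2) by (rule mono) simp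
      ultimately show False using M1(2) by blast
    qed
    then have "S' \<inter> {..<M'} \<inter> {..<Suc M} = insert M S"
      using S'(1) \<open>Suc M \<le> M'\<close> by (auto simp: less_Suc_eq)
    moreover have "Q M' (S' \<inter> {..<M'})" using S'(2) by (rule mono) simp
    ultimately show "\<exists>S'. S' \<inter> {..<Suc M} = insert M S \<and> Q M' S'" by blast
  qed
  define D where "D = rec_nat {} (\<lambda>M S. if ext (Suc M) S then S else insert M S)"
  have D: "D 0 = {}" "D (Suc M) = (if ext (Suc M) (D M) then D M else insert M (D M))" for M
    by (simp_all add: D_def)
  have ext_D: "ext M (D M)" for M
    by (induction M) (auto simp: D ext_0 intro: ext_Suc)
  define Z where "Z = (\<Union>M. D M)"
  have below: "D M \<subseteq> {..<M}" for M
    by (induction M) (auto simp: D less_Suc_eq)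
  have later: "D (M + k) \<inter> {..<M} = D M" for M k
  proof (induction k)
    case 0
    show ?case using below[of M] by auto
  next
    case (Suc k)
    have "D (M + Suc k) \<inter> {..<M} = D (M + k) \<inter> {..<M}" by (simp add: D)
    with Suc show ?case by simp
  qed
  have "Z \<inter> {..<M} = D M" for M
  proof
    show "Z \<inter> {..<M} \<subseteq> D M"
    proof
      fix m assume "m \<in> Z \<inter> {..<M}"
      then obtain M' where "m \<in> D M'" "m < M" unfolding Z_def by blast
      then show "m \<in> D M"
        using later[of M "M' - M"] later[of M' "M - M'"] by (cases "M \<le> M'") auto
    qed
  qed (use below in \<open>auto simp: Z_def\<close>)
  moreover have "Q M (D M)" for M
  proof -
    obtain S' where "S' \<inter> {..<M} = D M" "Q M S'" using ext_D[of M] unfolding ext_def by blast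
    then show ?thesis using mono[of M S' M] by simp
  qed
  ultimately show ?thesis by metis
qed

lemma set_decode_below: "\<exists>M. set_decode P \<subseteq> {..<M}"
  using finite_nat_bounded[OF finite_set_decode] by blast

lemma falsified_below_mono:
  assumes "falsified_below M (S \<inter> {..<M}) P N" "M \<le> M'"
  shows "falsified_below M' S P N"
proof -
  have "j < M' \<and> j \<notin> S" if "j \<in> set_decode P" for j
    using assms that unfolding falsified_below_def by force
  moreover have "set_decode N \<subseteq> S"
    using assms(1) unfolding falsified_below_def by blast
  ultimately show ?thesis unfolding falsified_below_def by auto
qed

text \<open>
  Compactness in the form of a finite refutation: at some level every partial valuation already
  falsifies a clause. Stated this way unsatisfiability is an existential condition whose only universal
  quantifier is bounded.
\<close>

theorem unsatisfiable_iff: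
  "\<not> satisfiable C \<longleftrightarrow> (\<exists>M. \<forall>S\<subseteq>{..<M}. \<exists>P N. C P N \<and> falsified_below M S P N)"
proof
  assume unsat: "\<not> satisfiable C"
  let ?Q = "\<lambda>M S. \<forall>P N. C P N \<longrightarrow> \<not> falsified_below M S P N"
  show "\<exists>M. \<forall>S\<subseteq>{..<M}. \<exists>P N. C P N \<and> falsified_below M S P N"
  proof (rule ccontr)
    assume "\<not> ?thesis"
    then have levels: "\<exists>S\<subseteq>{..<M}. ?Q M S" for M by meson
    have "\<exists>Z. \<forall>M. ?Q M (Z \<inter> {..<M})"
    proof (rule koenig_subsets[of ?Q])
      fix M M' S assume "?Q M' S" "M \<le> M'"
      then show "?Q M (S \<inter> {..<M})"
        using falsified_below_mono by meson
    qed (rule levels)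
    then obtain Z where Z: "?Q M (Z \<inter> {..<M})" for M by blast
    have "satisfies Z P N" if c: "C P N" for P N
    proof -
      obtain M M' where M: "set_decode P \<subseteq> {..<M}" "set_decode N \<subseteq> {..<M'}"
        using set_decode_below by metis
      let ?K = "max M M'"
      have K: "set_decode P \<subseteq> {..<?K}" "set_decode N \<subseteq> {..<?K}"
        by (auto dest!: subsetD[OF M(1)] subsetD[OF M(2)])
      have "\<not> falsified_below ?K (Z \<inter> {..<?K}) P N" using Z c by blast
      with K show ?thesis unfolding falsified_below_def satisfies_def by blast
    qed
    with unsat show False unfolding satisfiable_def by blast
  qed
next
  assume "\<exists>M. \<forall>S\<subseteq>{..<M}. \<exists>P N. C P N \<and> falsified_below M S P N"
  then obtain M where M: "\<And>S. S \<subseteq> {..<M} \<Longrightarrow> \<exists>P N. C P N \<and> falsified_below M S P N" by blast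
  show "\<not> satisfiable C"
  proof
    assume "satisfiable C"
    then obtain Z where Z: "\<And>P N. C P N \<Longrightarrow> satisfies Z P N" unfolding satisfiable_def by blast
    obtain P N where "C P N" "falsified_below M (Z \<inter> {..<M}) P N" using M[of "Z \<inter> {..<M}"] by blast
    with Z[of P N] show False unfolding falsified_below_def satisfies_def by blast
  qed
qed

text \<open>
  There are only finitely many valuations at the refuting level, and one falsified clause for each of
  them suffices.
\<close>

corollary propositional_compactness:
  assumes "\<not> satisfiable C"
  shows "\<exists>F. finite F \<and> (\<forall>(P, N)\<in>F. C P N) \<and> \<not> satisfiable (\<lambda>P N. (P, N) \<in> F)"
proof -
  obtain M where "\<forall>S\<subseteq>{..<M}. \<exists>P N. C P N \<and> falsified_below M S P N"
    using assms unfolding unsatisfiable_iff by blast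
  then obtain p n where pn: "\<And>S. S \<subseteq> {..<M} \<Longrightarrow> C (p S) (n S) \<and> falsified_below M S (p S) (n S)"
    by metis
  let ?F = "(\<lambda>S. (p S, n S)) ` Pow {..<M}"
  have "\<not> satisfiable (\<lambda>P N. (P, N) \<in> ?F)"
    unfolding unsatisfiable_iff using pn by blast
  moreover have "finite ?F" "\<forall>(P, N)\<in>?F. C P N" using pn by auto
  ultimately show ?thesis by blast
qed

lemma subset_lessThan_iff_set_decode: "S \<subseteq> {..<M} \<longleftrightarrow> (\<exists>z<2 ^ M. S = set_decode z)"
proof
  assume S: "S \<subseteq> {..<M}"
  then have fin: "finite S" using finite_subset by blast
  have "set_encode S \<le> set_encode {..<M}"
    unfolding set_encode_def using S by (intro sum_mono2) auto
  also have "\<dots> < 2 ^ M"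
    by (simp add: set_encode_def) (induction M, auto simp: lessThan_Suc)
  finally show "\<exists>z<2 ^ M. S = set_decode z"
    using set_encode_inverse[OF fin] by metis
next
  assume "\<exists>z<2 ^ M. S = set_decode z"
  then obtain z where z: "z < 2 ^ M" "S = set_decode z" by blast
  have "m < M" if "m \<in> S" for m
  proof (rule ccontr)
    assume "\<not> m < M"
    then have "(2::nat) ^ M \<le> 2 ^ m" by simp
    with z(1) have "z < 2 ^ m" by (rule less_le_trans)
    with that z(2) show False by (simp add: set_decode_def)
  qed
  then show "S \<subseteq> {..<M}" by blast
qed

lemma set_decode_less: "m \<in> set_decode z \<Longrightarrow> m < z"
proof -
  assume m: "m \<in> set_decode z"
  have "m < 2 ^ m" by (rule less_exp)
  also have "2 ^ m \<le> z"
    using m by (cases "z < 2 ^ m") (auto simp: set_decode_def)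
  finally show ?thesis .
qed

text \<open>
  The finite refutations can be enumerated uniformly in a parameter, as soon as the clauses can: by
  \<open>unsatisfiable_iff\<close> the quantifiers involved are existential or bounded.
\<close>

theorem semidecidable_unsatisfiable:
  assumes "semidecidable (\<lambda>q. C (pi1 q) (pi1 (pi2 q)) (pi2 (pi2 q)))"
  shows "semidecidable (\<lambda>n. \<not> satisfiable (C n))"
proof -
  let ?f = "\<lambda>M z P N. (\<forall>j<P. j \<in> set_decode P \<longrightarrow> j < M \<and> j \<notin> set_decode z) \<and>
      (\<forall>j<N. j \<in> set_decode N \<longrightarrow> j \<in> set_decode z)"
  have f: "falsified_below M (set_decode z) P N \<longleftrightarrow> ?f M z P N" for M z P N
    unfolding falsified_below_def using set_decode_less by blast
  have iff: "\<not> satisfiable (C n) \<longleftrightarrow> (\<exists>M. \<forall>z<2 ^ M. \<exists>P N. C n P N \<and> ?f M z P N)" for n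
    unfolding unsatisfiable_iff subset_lessThan_iff_set_decode f[symmetric] by blast
  have C: "semidecidable (\<lambda>q. C (f q) (g q) (h q))"
    if "computable f" "computable g" "computable h" for f g h
    using semidecidable_comp[OF assms, of "\<lambda>q. pair (f q) (pair (g q) (h q))"] that
    by (simp add: computability)
  show ?thesis
    unfolding iff
    by (intro semidecidable_ex semidecidable_bounded_all semidecidable_conj C
        semidecidable_decidable computability)
qed


section \<open>The free group on codes of words\<close>

text \<open>
  This is \<^const>\<open>cons_reduce\<close> on codes: the letters \<open>2 * i\<close> and \<open>Suc (2 * i)\<close> are inverse to each
  other, and \<open>Suc (pair a w)\<close> codes the word with first letter \<open>a\<close> and remainder \<open>w\<close>. Letters outside
  the generating set are dropped, so that multiplication by any number maps codes of reduced words to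
  codes of reduced words.
\<close>

definition push_letter :: "nat \<Rightarrow> nat \<Rightarrow> nat \<Rightarrow> nat" where
  "push_letter p a w =
     (if 2 * p \<le> a then w
      else if w \<noteq> 0 \<and> pi1 (w - 1) = (if odd a then a - 1 else Suc a) then pi2 (w - 1)
      else Suc (pair a w))"

definition word_mult :: "nat \<Rightarrow> nat \<Rightarrow> nat \<Rightarrow> nat" where
  "word_mult p u v = foldr (push_letter p) (list_decode u) v"

abbreviation word_codes :: "nat \<Rightarrow> nat set" where
  "word_codes p \<equiv> word_code ` carrier (free_group p)"

lemma computable_word_mult [computability]:
  assumes "computable u" "computable v" shows "computable (\<lambda>n. word_mult p (u n) (v n))"
  unfolding word_mult_def
proof (intro computable_foldr assms)
  show "computable (\<lambda>q. push_letter p (pi1 q) (pi2 q))"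
    unfolding push_letter_def by (intro computability)
qed

lemma word_code_simps [simp]:
  "word_code [] = 0" "word_code (a # w) = Suc (pair (letter_code a) (word_code w))"
  by (simp_all add: word_code_def)

lemma letter_code_inv_letter:
  "letter_code (inv_letter a) = (if odd (letter_code a) then letter_code a - 1 else Suc (letter_code a))"
  by (simp add: letter_code_def inv_letter_def)

lemma inj_letter_code: "inj letter_code"
proof (rule injI)
  fix a b assume "letter_code a = letter_code b"
  then have "(2 * fst a + of_bool (snd a)) div 2 = (2 * fst b + of_bool (snd b)) div 2"
      "odd (2 * fst a + of_bool (snd a)) = odd (2 * fst b + of_bool (snd b))"
    by (simp_all add: letter_code_def)
  then show "a = b" by (simp add: prod_eq_iff)
qed

lemma inj_word_code: "inj word_code"
  by (simp add: inj_on_def word_code_def list_encode_eq inj_map_eq_map[OF inj_letter_code])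

lemma letter_code_less_iff: "letter_code a < 2 * p \<longleftrightarrow> fst a < p"
  by (cases "snd a") (auto simp: letter_code_def)

lemma letter_code_surj: obtains x where "a = letter_code x"
proof
  show "a = letter_code (a div 2, odd a)" by (simp add: letter_code_def)
qed

lemma push_letter_code:
  assumes "fst a < p" shows "push_letter p (letter_code a) (word_code w) = word_code (cons_reduce a w)"
proof -
  have "\<not> 2 * p \<le> letter_code a" using assms by (simp add: not_le letter_code_less_iff)
  then show ?thesis
    by (cases w)
      (simp_all add: push_letter_def letter_code_inv_letter[symmetric] inj_eq[OF inj_letter_code])
qed

lemma word_mult_code:
  assumes "u \<in> carrier (free_group p)" "v \<in> carrier (free_group p)"
  shows "word_mult p (word_code u) (word_code v) = word_code (u \<otimes>\<^bsub>free_group p\<^esub> v)"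
proof -
  have "fst ` set u \<subseteq> {..<p}" using assms(1) by (simp add: free_group_def)
  then have "foldr (push_letter p) (map letter_code u) (word_code v) = word_code (foldr cons_reduce u v)"
    by (induction u) (simp_all add: push_letter_code del: word_code_simps)
  moreover have "u \<otimes>\<^bsub>free_group p\<^esub> v = foldr cons_reduce u v"
    using assms(2) by (simp add: free_group_def reduce_append reduce_reduced)
  ultimately show ?thesis by (simp add: word_mult_def word_code_def)
qed

lemma word_mult_in_word_codes:
  assumes "v \<in> word_codes p" shows "word_mult p u v \<in> word_codes p"
proof -
  have push_letter: "push_letter p a w \<in> word_codes p" if w: "w \<in> word_codes p" for a w
  proof (cases "2 * p \<le> a")
    case True
    then show ?thesis using w by (simp add: push_letter_def)
  next
    case False
    obtain x where x: "a = letter_code x" by (rule letter_code_surj)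
    with False have "fst x < p" by (simp add: not_le letter_code_less_iff)
    obtain w' where w': "w = word_code w'" "w' \<in> carrier (free_group p)" using w by blast
    have "set (cons_reduce x w') \<subseteq> insert x (set w')" by (cases w') auto
    then have "fst ` set (cons_reduce x w') \<subseteq> insert (fst x) (fst ` set w')" by blast
    also have "\<dots> \<subseteq> {..<p}" using w'(2) \<open>fst x < p\<close> by (simp add: free_group_def)
    finally have "cons_reduce x w' \<in> carrier (free_group p)"
      using w'(2) reduced_cons_reduce[of w' x] by (simp add: free_group_def)
    then show ?thesis using push_letter_code[OF \<open>fst x < p\<close>] x w'(1) by simp
  qed
  have "foldr (push_letter p) us v \<in> word_codes p" for us
    using assms push_letter by (induction us) simp_all
  then show ?thesis by (simp add: word_mult_def)
qed

text \<open>
  Multiplying by the empty word, whose code is \<open>0\<close>, reduces; the codes of reduced words in the given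
  generators are the fixed points. This makes the set of codes decidable.
\<close>

lemma word_codes_iff: "n \<in> word_codes p \<longleftrightarrow> word_mult p n 0 = n"
proof
  assume "n \<in> word_codes p"
  then obtain u where "n = word_code u" "u \<in> carrier (free_group p)" by blast
  moreover have "[] \<in> carrier (free_group p)" by (simp add: free_group_def)
  moreover have "u \<otimes>\<^bsub>free_group p\<^esub> [] = u"
    using \<open>u \<in> carrier (free_group p)\<close> by (simp add: free_group_def reduce_reduced)
  ultimately show "word_mult p n 0 = n" using word_mult_code[of u p "[]"] by simp
next
  have "0 \<in> word_codes p" by (rule image_eqI[of _ _ "[]"]) (simp_all add: free_group_def)
  then have "word_mult p n 0 \<in> word_codes p" by (rule word_mult_in_word_codes)
  then show "word_mult p n 0 = n \<Longrightarrow> n \<in> word_codes p" by simp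
qed


section \<open>Configurations as propositional valuations\<close>

text \<open>
  The variable \<open>pair i a\<close> says that the position with code \<open>i\<close> carries the letter numbered \<open>a\<close>. The
  clauses say that inserting an element \<open>t\<close> of \<open>T\<close> anywhere in a word does not change the letter
  found at that position. Inserting \<open>t\<close>, as opposed to appending it, gives invariance under all
  conjugates of \<open>t\<close>, because \<open>u t v = u v (v\<inverse> t v)\<close>.

  Clauses with superfluous literals are admitted. They are weaker than the intended ones, so they do not
  affect satisfiability, and membership in the canonical indices is the only test that remains.
\<close>

definition invariance_clauses :: "nat \<Rightarrow> nat set \<Rightarrow> nat \<Rightarrow> nat \<Rightarrow> bool" where
  "invariance_clauses p T P N \<longleftrightarrow>
     (\<exists>t u v a. t \<in> T \<and> u \<in> word_codes p \<and> v \<in> word_codes p \<and>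
        (let i = pair (word_mult p u (word_mult p t v)) a; j = pair (word_mult p u v) a in
          (i \<in> set_decode P \<and> j \<in> set_decode N) \<or> (j \<in> set_decode P \<and> i \<in> set_decode N)))"

text \<open>
  \<open>E\<close> consists of the codes of the forbidden patterns and \<open>V\<close> of the numbers of the letters. Each
  position has to carry some letter; it may carry several, as forbidden patterns become easier to match
  and choosing one letter per position still gives a configuration.
\<close>

definition configuration_clauses :: "nat \<Rightarrow> nat set \<Rightarrow> nat set \<Rightarrow> nat set \<Rightarrow> nat \<Rightarrow> nat \<Rightarrow> bool" where
  "configuration_clauses p E V T P N \<longleftrightarrow>
     N \<in> E \<or> (\<exists>i. \<forall>v\<in>V. pair i v \<in> set_decode P) \<or> invariance_clauses p T P N"

lemma satisfies_configuration_clauses_iff: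
  assumes "finite V"
  shows "(\<forall>P N. configuration_clauses p E V T P N \<longrightarrow> satisfies Z P N) \<longleftrightarrow>
    (\<forall>c\<in>E. \<not> set_decode c \<subseteq> Z) \<and> (\<forall>i. \<exists>v\<in>V. pair i v \<in> Z) \<and>
    (\<forall>t\<in>T. \<forall>u\<in>word_codes p. \<forall>v\<in>word_codes p. \<forall>a.
       pair (word_mult p u (word_mult p t v)) a \<in> Z \<longleftrightarrow> pair (word_mult p u v) a \<in> Z)"
    (is "?sat \<longleftrightarrow> ?E \<and> ?V \<and> ?T")
proof
  assume sat: ?sat
  have ?E
  proof
    fix c assume "c \<in> E"
    then have "configuration_clauses p E V T 0 c" by (simp add: configuration_clauses_def)
    with sat have "satisfies Z 0 c" by blast
    then show "\<not> set_decode c \<subseteq> Z" by (simp add: satisfies_def)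
  qed
  moreover have ?V
  proof
    fix i
    let ?P = "set_encode (pair i ` V)"
    have P: "set_decode ?P = pair i ` V" using assms by (simp add: set_encode_inverse)
    then have "configuration_clauses p E V T ?P 0" unfolding configuration_clauses_def by blast
    with sat have "satisfies Z ?P 0" by blast
    then show "\<exists>v\<in>V. pair i v \<in> Z" unfolding satisfies_def P by auto
  qed
  moreover have ?T
  proof (intro ballI allI)
    fix t u v a assume *: "t \<in> T" "u \<in> word_codes p" "v \<in> word_codes p"
    let ?i = "pair (word_mult p u (word_mult p t v)) a" and ?j = "pair (word_mult p u v) a"
    have single: "set_decode (set_encode {k}) = {k}" for k
      by (rule set_encode_inverse) simp
    have "invariance_clauses p T (set_encode {k}) (set_encode {l})"
      if "k = ?i \<and> l = ?j \<or> k = ?j \<and> l = ?i" for k l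
      unfolding invariance_clauses_def Let_def single
      by (rule exI[of _ t], rule exI[of _ u], rule exI[of _ v], rule exI[of _ a])
        (use * that in auto)
    then have "invariance_clauses p T (set_encode {?i}) (set_encode {?j})"
        "invariance_clauses p T (set_encode {?j}) (set_encode {?i})"
      by simp_all
    with sat have "satisfies Z (set_encode {?i}) (set_encode {?j})"
        "satisfies Z (set_encode {?j}) (set_encode {?i})"
      unfolding configuration_clauses_def by blast+
    then show "?i \<in> Z \<longleftrightarrow> ?j \<in> Z" unfolding satisfies_def single by blast
  qed
  ultimately show "?E \<and> ?V \<and> ?T" by blast
next
  assume *: "?E \<and> ?V \<and> ?T"
  show ?sat
  proof (intro allI impI)
    fix P N assume "configuration_clauses p E V T P N"
    then consider "N \<in> E" | i where "\<forall>v\<in>V. pair i v \<in> set_decode P" | "invariance_clauses p T P N"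
      unfolding configuration_clauses_def by blast
    then show "satisfies Z P N"
    proof cases
      case 1
      with * show ?thesis unfolding satisfies_def by blast
    next
      case 2
      from * obtain v where "v \<in> V" "pair i v \<in> Z" by blast
      with 2 show ?thesis unfolding satisfies_def by blast
    next
      case 3
      then obtain t u v a where c: "t \<in> T" "u \<in> word_codes p" "v \<in> word_codes p"
        and d: "(pair (word_mult p u (word_mult p t v)) a \<in> set_decode P \<and> pair (word_mult p u v) a \<in> set_decode N)
          \<or> (pair (word_mult p u v) a \<in> set_decode P \<and> pair (word_mult p u (word_mult p t v)) a \<in> set_decode N)"
        unfolding invariance_clauses_def Let_def by blast
      have "pair (word_mult p u (word_mult p t v)) a \<in> Z \<longleftrightarrow> pair (word_mult p u v) a \<in> Z"
        using * c by blast
      with d show ?thesis unfolding satisfies_def by blast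
    qed
  qed
qed

text \<open>
  The normal core of the stabilizer of \<open>x\<close>, in a form that refers to the values of \<open>x\<close> only. For
  \<open>b = t\<inverse> k\<close> and \<open>a = h\<inverse>\<close> the condition says that \<open>t\<close> fixes the translate of \<open>x\<close> by \<open>h\<close>.
\<close>

definition invariance_core :: "('g, 'm) monoid_scheme \<Rightarrow> ('g \<Rightarrow> 'a) \<Rightarrow> 'g set" where
  "invariance_core G x = {t \<in> carrier G. \<forall>a\<in>carrier G. \<forall>b\<in>carrier G.
     x (a \<otimes>\<^bsub>G\<^esub> (t \<otimes>\<^bsub>G\<^esub> b)) = x (a \<otimes>\<^bsub>G\<^esub> b)}"

lemma invariance_core_subset:
  assumes "group G"
  shows "invariance_core G x \<subseteq> (\<Inter>h\<in>carrier G. stabilizer G (shift G) (shift G h x))"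
proof
  interpret group G by fact
  fix t assume "t \<in> invariance_core G x"
  then have t: "t \<in> carrier G"
    and inv: "\<And>a b. a \<in> carrier G \<Longrightarrow> b \<in> carrier G \<Longrightarrow> x (a \<otimes>\<^bsub>G\<^esub> (t \<otimes>\<^bsub>G\<^esub> b)) = x (a \<otimes>\<^bsub>G\<^esub> b)"
    unfolding invariance_core_def by auto
  have "shift G t (shift G h x) = shift G h x" if h: "h \<in> carrier G" for h
  proof
    fix k
    show "shift G t (shift G h x) k = shift G h x k"
    proof (cases "k \<in> carrier G")
      case True
      have "t \<otimes>\<^bsub>G\<^esub> (inv\<^bsub>G\<^esub> t \<otimes>\<^bsub>G\<^esub> k) = k" using t True by (simp flip: m_assoc)
      then have "x (inv\<^bsub>G\<^esub> h \<otimes>\<^bsub>G\<^esub> (inv\<^bsub>G\<^esub> t \<otimes>\<^bsub>G\<^esub> k)) = x (inv\<^bsub>G\<^esub> h \<otimes>\<^bsub>G\<^esub> k)"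
        using inv[of "inv\<^bsub>G\<^esub> h" "inv\<^bsub>G\<^esub> t \<otimes>\<^bsub>G\<^esub> k"] t h True by simp
      then show ?thesis using t True by (simp add: shift_def)
    qed (simp add: shift_def)
  qed
  then show "t \<in> (\<Inter>h\<in>carrier G. stabilizer G (shift G) (shift G h x))"
    using t by (simp add: stabilizer_def)
qed

locale marked_group = group G for G :: "('g, 'm) monoid_scheme" (structure) +
  fixes p :: nat and \<phi> :: "letter list \<Rightarrow> 'g"
  assumes epi: "\<phi> \<in> epi (free_group p) G"
begin

abbreviation F :: "letter list monoid" where "F \<equiv> free_group p"

abbreviation relators :: "nat set" where "relators \<equiv> word_code ` kernel F G \<phi>"

definition core_codes :: "('g \<Rightarrow> 'a) \<Rightarrow> nat set" where
  "core_codes x = word_code ` {w \<in> carrier F. \<phi> w \<in> invariance_core G x}"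

lemma group_hom_quotient: "group_hom F G \<phi>"
  using epi group_free_group group_axioms
  by (simp add: epi_def group_hom_def group_hom_axioms_def)

lemma surj: assumes "h \<in> carrier G" obtains w where "w \<in> carrier F" "\<phi> w = h"
proof -
  have "h \<in> \<phi> ` carrier F" using epi assms by (simp add: epi_def)
  then show thesis using that by auto
qed

lemma core_codes_subset: "core_codes x \<subseteq> word_codes p"
  unfolding core_codes_def by blast

lemma relators_subset: "relators \<subseteq> core_codes x"
proof -
  interpret quotient: group_hom F G \<phi> by (rule group_hom_quotient)
  show ?thesis
    unfolding core_codes_def kernel_def invariance_core_def by auto
qed

text \<open>
  A configuration satisfies its own description; positions that are not codes of reduced words occur in
  no pattern and in no invariance clause, so all their variables may be true.
\<close>

lemma satisfiable_if_configuration: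
  assumes "finite A" "inj_on e A" "L \<subseteq> patterns p A"
    and x: "x \<in> avoiding_configurations G \<phi> A L"
  shows "satisfiable (configuration_clauses p (pattern_code e ` L) (e ` A) (core_codes x))"
proof -
  interpret quotient: group_hom F G \<phi> by (rule group_hom_quotient)
  define Z where "Z = {k. \<forall>w\<in>carrier F. pi1 k = word_code w \<longrightarrow> pi2 k = e (x (\<phi> w))}"
  have Z: "pair (word_code w) a \<in> Z \<longleftrightarrow> a = e (x (\<phi> w))" if "w \<in> carrier F" for w a
    using that by (auto simp: Z_def inj_eq[OF inj_word_code])
  have xA: "x h \<in> A" if "h \<in> carrier G" for h
    using x that unfolding avoiding_configurations_def configurations_def by auto
  have "\<not> set_decode (pattern_code e w) \<subseteq> Z" if w: "w \<in> L" for w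
  proof
    assume sub: "set_decode (pattern_code e w) \<subseteq> Z"
    from w assms(3) have dom: "finite (dom w)" "dom w \<subseteq> carrier F" and ran: "ran w \<subseteq> A"
      unfolding patterns_def by auto
    obtain g where g: "g \<in> dom w" "w g \<noteq> Some (x (\<phi> g))"
      using x w unfolding avoiding_configurations_def disagrees_def by blast
    then obtain a where a: "w g = Some a" by blast
    have "set_decode (pattern_code e w) = (\<lambda>g. pair (word_code g) (e (the (w g)))) ` dom w"
      unfolding pattern_code_def using dom(1) by (simp add: set_encode_inverse)
    with sub g(1) have "pair (word_code g) (e (the (w g))) \<in> Z" by blast
    then have "e a = e (x (\<phi> g))" using Z g(1) dom(2) a by auto
    moreover have "a \<in> A" using a ran by (auto simp: ran_def)
    moreover have "x (\<phi> g) \<in> A" using xA g(1) dom(2) by auto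
    ultimately have "a = x (\<phi> g)" by (rule inj_onD[OF assms(2)])
    with a g(2) show False by simp
  qed
  moreover have "\<exists>v\<in>e ` A. pair i v \<in> Z" for i
  proof (cases "i \<in> word_codes p")
    case True
    then show ?thesis using Z xA by auto
  next
    case False
    then have "pair i (e (x \<one>)) \<in> Z" by (auto simp: Z_def)
    then show ?thesis using xA by blast
  qed
  moreover have "pair (word_mult p u (word_mult p t v)) a \<in> Z \<longleftrightarrow> pair (word_mult p u v) a \<in> Z"
    if "t \<in> core_codes x" "u \<in> word_codes p" "v \<in> word_codes p" for t u v a
  proof -
    from that obtain t' u' v' where c: "t = word_code t'" "u = word_code u'" "v = word_code v'"
        "t' \<in> carrier F" "u' \<in> carrier F" "v' \<in> carrier F" and core: "\<phi> t' \<in> invariance_core G x"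
      unfolding core_codes_def by blast
    have "x (\<phi> (u' \<otimes>\<^bsub>F\<^esub> (t' \<otimes>\<^bsub>F\<^esub> v'))) = x (\<phi> (u' \<otimes>\<^bsub>F\<^esub> v'))"
      using core c(4-6) unfolding invariance_core_def by simp
    then show ?thesis using c(4-6) by (simp add: c(1-3) word_mult_code Z)
  qed
  ultimately have "\<forall>P N. configuration_clauses p (pattern_code e ` L) (e ` A) (core_codes x) P N
      \<longrightarrow> satisfies Z P N"
    using assms(1) by (subst satisfies_configuration_clauses_iff) auto
  then show ?thesis unfolding satisfiable_def by blast
qed

text \<open>
  Choose at each position one of the letters that the valuation allows. The chosen letter depends only
  on the set of allowed letters, which the invariance clauses preserve. Invariance under the relators
  makes the choice constant on the fibres of \<open>\<phi>\<close>, and so defines a configuration on \<open>G\<close>.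
\<close>

lemma configuration_if_satisfiable:
  assumes "finite A" "inj_on e A" "L \<subseteq> patterns p A" "relators \<subseteq> T" "T \<subseteq> word_codes p"
    and sat: "satisfiable (configuration_clauses p (pattern_code e ` L) (e ` A) T)"
  shows "\<exists>x\<in>avoiding_configurations G \<phi> A L. T \<subseteq> core_codes x"
proof -
  interpret F: group F by (rule group_free_group)
  interpret quotient: group_hom F G \<phi> by (rule group_hom_quotient)
  obtain Z where "\<forall>P N. configuration_clauses p (pattern_code e ` L) (e ` A) T P N \<longrightarrow> satisfies Z P N"
    using sat unfolding satisfiable_def by blast
  note Z = this[unfolded satisfies_configuration_clauses_iff[OF finite_imageI[OF assms(1)]]]
  from Z have Z: "\<And>w. w \<in> L \<Longrightarrow> \<not> set_decode (pattern_code e w) \<subseteq> Z" "\<And>i. \<exists>v\<in>e ` A. pair i v \<in> Z"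
    "\<And>t u v a. t \<in> T \<Longrightarrow> u \<in> word_codes p \<Longrightarrow> v \<in> word_codes p \<Longrightarrow>
       pair (word_mult p u (word_mult p t v)) a \<in> Z \<longleftrightarrow> pair (word_mult p u v) a \<in> Z"
    by blast+
  \<comment> \<open>The choice depends on \<open>i\<close> only through the set of allowed letters.\<close>
  define y where "y i = (SOME a. a \<in> A \<and> pair i (e a) \<in> Z)" for i
  have y: "y i \<in> A" "pair i (e (y i)) \<in> Z" for i
    using someI_ex[of "\<lambda>a. a \<in> A \<and> pair i (e a) \<in> Z"] Z(2)[of i] unfolding y_def by auto
  have y_invariant: "y (word_code (u \<otimes>\<^bsub>F\<^esub> (t \<otimes>\<^bsub>F\<^esub> v))) = y (word_code (u \<otimes>\<^bsub>F\<^esub> v))"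
    if "word_code t \<in> T" "t \<in> carrier F" "u \<in> carrier F" "v \<in> carrier F" for t u v
    using Z(3)[of "word_code t" "word_code u" "word_code v"] that
    by (simp add: word_mult_code y_def)
  define x where "x = (\<lambda>h\<in>carrier G. y (word_code (SOME w. w \<in> carrier F \<and> \<phi> w = h)))"
  have x: "x (\<phi> w) = y (word_code w)" if w: "w \<in> carrier F" for w
  proof -
    define w' where "w' = (SOME w'. w' \<in> carrier F \<and> \<phi> w' = \<phi> w)"
    have w': "w' \<in> carrier F" "\<phi> w' = \<phi> w"
      using someI_ex[of "\<lambda>w'. w' \<in> carrier F \<and> \<phi> w' = \<phi> w"] w unfolding w'_def by blast+
    let ?k = "inv\<^bsub>F\<^esub> w \<otimes>\<^bsub>F\<^esub> w'"
    have "?k \<in> kernel F G \<phi>" using w w' by (simp add: kernel_def)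
    then have "word_code ?k \<in> T" using assms(4) by blast
    from y_invariant[OF this, of w "\<one>\<^bsub>F\<^esub>"] have "y (word_code (w \<otimes>\<^bsub>F\<^esub> ?k)) = y (word_code w)"
      using w w' by simp
    moreover have "w \<otimes>\<^bsub>F\<^esub> ?k = w'" using w w' by (simp flip: F.m_assoc)
    ultimately show ?thesis using w by (simp add: x_def w'_def)
  qed
  have "x \<in> configurations G A" unfolding configurations_def x_def using y(1) by auto
  moreover have "disagrees \<phi> x w" if w: "w \<in> L" for w
  proof (rule ccontr)
    assume "\<not> disagrees \<phi> x w"
    then have agree: "w g = Some (x (\<phi> g))" if "g \<in> dom w" for g
      using that unfolding disagrees_def by blast
    have dom: "finite (dom w)" "dom w \<subseteq> carrier F"
      using w assms(3) unfolding patterns_def by auto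
    have "set_decode (pattern_code e w) = (\<lambda>g. pair (word_code g) (e (the (w g)))) ` dom w"
      unfolding pattern_code_def using dom(1) by (simp add: set_encode_inverse)
    also have "\<dots> \<subseteq> Z"
    proof
      fix k assume "k \<in> (\<lambda>g. pair (word_code g) (e (the (w g)))) ` dom w"
      then obtain g where g: "g \<in> dom w" "k = pair (word_code g) (e (the (w g)))" by blast
      then show "k \<in> Z" using agree[OF g(1)] x dom(2) y(2) by auto
    qed
    finally show False using Z(1) w by blast
  qed
  moreover have "T \<subseteq> core_codes x"
  proof
    fix t assume t: "t \<in> T"
    then obtain t' where t': "t = word_code t'" "t' \<in> carrier F" using assms(5) by blast
    have "x (a \<otimes> (\<phi> t' \<otimes> b)) = x (a \<otimes> b)" if ab: "a \<in> carrier G" "b \<in> carrier G" for a b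
    proof -
      obtain u where u: "u \<in> carrier F" "\<phi> u = a" using ab(1) by (rule surj)
      obtain v where v: "v \<in> carrier F" "\<phi> v = b" using ab(2) by (rule surj)
      have "x (\<phi> (u \<otimes>\<^bsub>F\<^esub> (t' \<otimes>\<^bsub>F\<^esub> v))) = x (\<phi> (u \<otimes>\<^bsub>F\<^esub> v))"
        using y_invariant[of t' u v] t t' u v by (simp add: x del: quotient.hom_mult)
      then show ?thesis using t'(2) u v by simp
    qed
    then show "t \<in> core_codes x"
      unfolding core_codes_def invariance_core_def using t' by simp
  qed
  ultimately show ?thesis unfolding avoiding_configurations_def by blast
qed

end


section \<open>Deciding the word problem\<close>

lemma decidable_mem_finite [computability]:
  assumes "finite S" "computable f" shows "decidable (\<lambda>n. f n \<in> S)"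
  using assms(1)
proof (induction S)
  case empty
  have "decidable (\<lambda>n. \<not> (0::nat) = 0)" by (intro computability)
  then show ?case by simp
next
  case (insert a S)
  have "decidable (\<lambda>n. f n = a \<or> f n \<in> S)" by (intro computability assms(2) insert.IH)
  then show ?case by simp
qed

lemma satisfiable_antimono:
  assumes "satisfiable D" "\<And>P N. C P N \<Longrightarrow> D P N" shows "satisfiable C"
  using assms unfolding satisfiable_def by blast

lemma configuration_clauses_mono:
  "configuration_clauses p E V T P N \<Longrightarrow> T \<subseteq> T' \<Longrightarrow> configuration_clauses p E V T' P N"
  unfolding configuration_clauses_def invariance_clauses_def by blast

text \<open>
  An invariance clause mentions a single element of \<open>T\<close>, so a finite unsatisfiable set of clauses for
  the union already belongs to one member of the chain.
\<close>

lemma satisfiable_Union_chain: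
  assumes "\<T> \<noteq> {}" "subset.chain S \<T>"
    and sat: "\<And>T. T \<in> \<T> \<Longrightarrow> satisfiable (configuration_clauses p E V T)"
  shows "satisfiable (configuration_clauses p E V (\<Union>\<T>))"
proof (rule ccontr)
  assume "\<not> satisfiable (configuration_clauses p E V (\<Union>\<T>))"
  then obtain F where F: "finite F" "\<forall>(P, N)\<in>F. configuration_clauses p E V (\<Union>\<T>) P N"
    "\<not> satisfiable (\<lambda>P N. (P, N) \<in> F)"
    using propositional_compactness by blast
  from F(1,2) have "\<exists>T\<in>\<T>. \<forall>(P, N)\<in>F. configuration_clauses p E V T P N"
  proof (induction F)
    case empty
    then show ?case using assms(1) by auto
  next
    case (insert c F)
    then obtain T where T: "T \<in> \<T>" "\<forall>(P, N)\<in>F. configuration_clauses p E V T P N" by auto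
    obtain P N where c: "c = (P, N)" by (cases c)
    have "configuration_clauses p E V (\<Union>\<T>) P N" using insert.prems c by auto
    then have "\<exists>T'\<in>\<T>. configuration_clauses p E V T' P N"
      using T(1) unfolding configuration_clauses_def invariance_clauses_def by blast
    then obtain T' where T': "T' \<in> \<T>" "configuration_clauses p E V T' P N" by blast
    have "T \<subseteq> T' \<or> T' \<subseteq> T" using assms(2) T(1) T'(1) by (auto simp: subset.chain_def)
    then have *: "T \<union> T' \<in> \<T>" using T(1) T'(1) by (auto simp: Un_absorb1 Un_absorb2)
    have "\<forall>(P, N)\<in>insert c F. configuration_clauses p E V (T \<union> T') P N"
      using T(2) T'(2) configuration_clauses_mono[OF _ Un_upper1] configuration_clauses_mono[OF _ Un_upper2]
      unfolding c by blast
    with * show ?case by blast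
  qed
  then obtain T where T: "T \<in> \<T>" "\<forall>(P, N)\<in>F. configuration_clauses p E V T P N" by blast
  have "satisfiable (\<lambda>P N. (P, N) \<in> F)"
    by (rule satisfiable_antimono[OF sat[OF T(1)]]) (use T(2) in blast)
  with F(3) show False by blast
qed

lemma semidecidable_configuration_clauses:
  assumes E: "semidecidable (\<lambda>n. n \<in> E)" and V: "finite V"
    and T: "semidecidable (\<lambda>q. pi2 q \<in> T (pi1 q))"
  shows "semidecidable (\<lambda>q. configuration_clauses p E V (T (pi1 q)) (pi1 (pi2 q)) (pi2 (pi2 q)))"
proof -
  have T': "semidecidable (\<lambda>q. f q \<in> T (g q))" if "computable f" "computable g" for f g
    using semidecidable_comp[OF T computable_pair[OF that(2,1)]] by simp
  have E': "semidecidable (\<lambda>q. f q \<in> E)" if "computable f" for f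
    using semidecidable_comp[OF E that] .
  show ?thesis
    unfolding configuration_clauses_def invariance_clauses_def Let_def word_codes_iff
    by (intro semidecidable_disj semidecidable_ex semidecidable_finite_all[OF V] semidecidable_conj E' T'
        semidecidable_decidable computability)
qed

context marked_group
begin

text \<open>
  Among all sets of words that act trivially on some allowed configuration, in the sense of the
  invariance clauses, take a maximal one; it is the set \<open>M\<close> of all words whose image lies in the finite
  normal core of some \<open>x\<close>. A configuration on which the relators and the finite set \<open>R\<close> of
  representatives of that core act trivially is invariant under all of \<open>M\<close>. By maximality a word outside \<open>M\<close> cannot be added
  consistently, which is confirmed by a finite refutation. A word in \<open>M\<close> that is not a relator is the
  product of a representative which is not a relator and a relator, and this can be confirmed as well.
  So non-relators are semidecidable, and Post's theorem applies.
\<close>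

theorem decidable_relators:
  assumes rp: "semidecidable (\<lambda>n. n \<in> relators)"
    and A: "finite A" "inj_on e A" and L: "L \<subseteq> patterns p A"
    and E: "semidecidable (\<lambda>n. n \<in> pattern_code e ` L)"
    and nonempty: "avoiding_configurations G \<phi> A L \<noteq> {}"
    and finite_core: "\<And>x. x \<in> avoiding_configurations G \<phi> A L \<Longrightarrow> finite (invariance_core G x)"
  shows "decidable (\<lambda>n. n \<in> relators)"
proof -
  interpret F: group F by (rule group_free_group)
  interpret quotient: group_hom F G \<phi> by (rule group_hom_quotient)
  let ?X = "avoiding_configurations G \<phi> A L"
  define sat where "sat T \<longleftrightarrow> satisfiable (configuration_clauses p (pattern_code e ` L) (e ` A) T)" for T
  have sat_core: "sat (core_codes x)" if "x \<in> ?X" for x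
    unfolding sat_def using satisfiable_if_configuration[OF A L that] .
  have sat_mono: "sat T" if "sat T'" "T \<subseteq> T'" for T T'
    using that(1) configuration_clauses_mono[OF _ that(2)] unfolding sat_def
    by (rule satisfiable_antimono)
  have core_if_sat: "\<exists>x\<in>?X. T \<subseteq> core_codes x"
    if "relators \<subseteq> T" "T \<subseteq> word_codes p" "sat T" for T
    using configuration_if_satisfiable[OF A L that(1,2)] that(3) unfolding sat_def .
  define \<C> where "\<C> = {T. relators \<subseteq> T \<and> T \<subseteq> word_codes p \<and> sat T}"
  have core_\<C>: "core_codes x \<in> \<C>" if "x \<in> ?X" for x
    unfolding \<C>_def using relators_subset core_codes_subset sat_core[OF that] by blast
  \<comment> \<open>Zorn, with compactness providing upper bounds for chains.\<close>
  have "\<exists>M\<in>\<C>. \<forall>T\<in>\<C>. M \<subseteq> T \<longrightarrow> T = M"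
  proof (rule subset_Zorn_nonempty)
    show "\<C> \<noteq> {}" using nonempty core_\<C> by blast
  next
    fix \<T> assume \<T>: "\<T> \<noteq> {}" "subset.chain \<C> \<T>"
    then have sub: "\<T> \<subseteq> \<C>" by (simp add: subset.chain_def)
    have "sat (\<Union>\<T>)"
      unfolding sat_def
      by (rule satisfiable_Union_chain[OF \<T>]) (use sub in \<open>auto simp: \<C>_def sat_def\<close>)
    moreover have "relators \<subseteq> \<Union>\<T>" "\<Union>\<T> \<subseteq> word_codes p"
      using sub \<T>(1) unfolding \<C>_def by blast+
    ultimately show "\<Union>\<T> \<in> \<C>" unfolding \<C>_def by blast
  qed
  then obtain M where M: "M \<in> \<C>" "\<And>T. T \<in> \<C> \<Longrightarrow> M \<subseteq> T \<Longrightarrow> T = M" by blast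
  from M(1) have relators_M: "relators \<subseteq> M" and M_codes: "M \<subseteq> word_codes p" and sat_M: "sat M"
    unfolding \<C>_def mem_Collect_eq by simp_all
  obtain x where x: "x \<in> ?X" "M \<subseteq> core_codes x"
    using core_if_sat[OF relators_M M_codes sat_M] by (elim bexE)
  have M_eq: "M = core_codes x" using M(2)[OF core_\<C>[OF x(1)] x(2)] by (rule sym)
  have "\<forall>h\<in>carrier G. \<exists>w. w \<in> carrier F \<and> \<phi> w = h" using surj by metis
  then obtain rep where rep: "\<And>h. h \<in> carrier G \<Longrightarrow> rep h \<in> carrier F \<and> \<phi> (rep h) = h"
    by metis
  define R where "R = (\<lambda>h. word_code (rep h)) ` invariance_core G x"
  have core_sub: "invariance_core G x \<subseteq> carrier G" unfolding invariance_core_def by blast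
  have "finite R" unfolding R_def using finite_core[OF x(1)] by simp
  have core_codes_iff: "word_code w \<in> core_codes y \<longleftrightarrow> \<phi> w \<in> invariance_core G y"
    if "w \<in> carrier F" for w and y :: "'g \<Rightarrow> 'a"
    using that unfolding core_codes_def by (auto simp: inj_eq[OF inj_word_code])
  have R_M: "R \<subseteq> M"
  proof
    fix r assume "r \<in> R"
    then obtain h where h: "h \<in> invariance_core G x" "r = word_code (rep h)"
      unfolding R_def by (elim imageE)
    with rep[of h] core_sub show "r \<in> M" by (auto simp: M_eq core_codes_iff)
  qed
  \<comment> \<open>The representatives together with the relators already force the whole of \<open>M\<close>.\<close>
  have M_if_sat: "n \<in> M" if n: "n \<in> word_codes p" "sat (insert n (relators \<union> R))" for n
  proof -
    from M_codes R_M n(1) have "insert n (relators \<union> R) \<subseteq> word_codes p"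
      using relators_M by (meson insert_subset le_sup_iff order_trans)
    from core_if_sat[OF _ this n(2)] obtain y where y: "y \<in> ?X" "insert n (relators \<union> R) \<subseteq> core_codes y"
      by blast
    have "M \<subseteq> core_codes y"
    proof
      fix m assume "m \<in> M"
      then obtain w where w: "m = word_code w" "w \<in> carrier F" "\<phi> w \<in> invariance_core G x"
        unfolding M_eq core_codes_def by blast
      then have "word_code (rep (\<phi> w)) \<in> core_codes y" using y(2) unfolding R_def by blast
      then show "m \<in> core_codes y"
        using rep[of "\<phi> w"] w(1,2) by (simp add: core_codes_iff)
    qed
    then have "core_codes y = M" by (rule M(2)[OF core_\<C>[OF y(1)]])
    with y(2) show ?thesis by simp
  qed
  have relators_iff: "word_code w \<in> relators \<longleftrightarrow> \<phi> w = \<one>" if "w \<in> carrier F" for w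
    using that unfolding kernel_def by (auto simp: inj_eq[OF inj_word_code])
  have complement: "n \<notin> relators \<longleftrightarrow>
      word_mult p n 0 \<noteq> n \<or> \<not> sat (insert n (relators \<union> R)) \<or>
      (\<exists>r k. r \<in> R - relators \<and> k \<in> relators \<and> n = word_mult p r k)" for n
  proof
    assume n: "n \<notin> relators"
    show "word_mult p n 0 \<noteq> n \<or> \<not> sat (insert n (relators \<union> R)) \<or>
      (\<exists>r k. r \<in> R - relators \<and> k \<in> relators \<and> n = word_mult p r k)"
    proof (cases "n \<in> word_codes p \<and> sat (insert n (relators \<union> R))")
      case True
      then have "n \<in> M" using M_if_sat by blast
      then obtain w where w: "n = word_code w" "w \<in> carrier F" "\<phi> w \<in> invariance_core G x"
        unfolding M_eq core_codes_def by blast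
      define r where "r = rep (\<phi> w)"
      have r: "r \<in> carrier F" "\<phi> r = \<phi> w" using rep[of "\<phi> w"] w(2) by (auto simp: r_def)
      define k where "k = inv\<^bsub>F\<^esub> r \<otimes>\<^bsub>F\<^esub> w"
      have k: "k \<in> carrier F" "\<phi> k = \<one>" using r w(2) by (simp_all add: k_def)
      have "r \<otimes>\<^bsub>F\<^esub> k = w" using r w(2) by (simp add: k_def flip: F.m_assoc)
      then have "n = word_mult p (word_code r) (word_code k)"
        using r(1) k(1) w(1) by (simp add: word_mult_code)
      moreover have "word_code r \<in> R" unfolding R_def r_def using w(3) by (rule imageI)
      moreover have "word_code r \<notin> relators"
        using n w(1) r relators_iff[OF r(1)] relators_iff[OF w(2)] by metis
      moreover have "word_code k \<in> relators" using k relators_iff[OF k(1)] by metis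
      ultimately show ?thesis by blast
    qed (auto simp: word_codes_iff)
  next
    assume "word_mult p n 0 \<noteq> n \<or> \<not> sat (insert n (relators \<union> R)) \<or>
      (\<exists>r k. r \<in> R - relators \<and> k \<in> relators \<and> n = word_mult p r k)"
    then consider "n \<notin> word_codes p" | "\<not> sat (insert n (relators \<union> R))"
      | r k where "r \<in> R" "r \<notin> relators" "k \<in> relators" "n = word_mult p r k"
      unfolding word_codes_iff by blast
    then show "n \<notin> relators"
    proof cases
      case 1
      then show ?thesis unfolding kernel_def by blast
    next
      case 2
      moreover have "sat (relators \<union> R)"
        by (rule sat_mono[of M]) (use sat_M R_M relators_M in simp_all)
      ultimately show ?thesis by (metis Un_iff insert_absorb)
    next
      case (3 r k)
      have "r \<in> word_codes p" using 3(1) R_M M_codes by blast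
      then obtain r' where r': "r = word_code r'" "r' \<in> carrier F" by blast
      obtain k' where k': "k = word_code k'" "k' \<in> carrier F" "\<phi> k' = \<one>"
        using 3(3) unfolding kernel_def by blast
      have "n = word_code (r' \<otimes>\<^bsub>F\<^esub> k')" using 3(4) r' k' by (simp add: word_mult_code)
      moreover have "\<phi> (r' \<otimes>\<^bsub>F\<^esub> k') \<noteq> \<one>"
        using 3(2) r' k' relators_iff[OF r'(2)] by simp
      ultimately show ?thesis using relators_iff[of "r' \<otimes>\<^bsub>F\<^esub> k'"] r'(2) k'(2) by simp
    qed
  qed
  have relators: "semidecidable (\<lambda>n. f n \<in> relators)" if "computable f" for f
    using semidecidable_comp[OF rp that] .
  have "semidecidable (\<lambda>q. pi2 q \<in> insert (pi1 q) (relators \<union> R))"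
    unfolding insert_iff Un_iff
    by (intro semidecidable_disj relators semidecidable_decidable computability \<open>finite R\<close>)
  from semidecidable_unsatisfiable[OF semidecidable_configuration_clauses[OF E finite_imageI[OF A(1)] this]]
  have unsat: "semidecidable (\<lambda>n. \<not> sat (insert n (relators \<union> R)))"
    unfolding sat_def .
  have "finite (R - relators)" using \<open>finite R\<close> by simp
  then have "semidecidable (\<lambda>n. n \<notin> relators)"
    unfolding complement
    by (intro semidecidable_disj unsat semidecidable_ex semidecidable_conj relators
        semidecidable_decidable computability)
  with rp show ?thesis by (rule decidable_by_complement)
qed

end

theorem theorem1:
  fixes G :: "('g, 'm) monoid_scheme" and p :: nat and \<phi> :: "letter list \<Rightarrow> 'g"
  assumes "group G"
    and "\<phi> \<in> epi (free_group p) G"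
    and "recursively_presented p G \<phi>"
    and "\<exists>(A :: 'a set) X. finite A \<and> subshift G A X \<and> effectively_closed p G \<phi> A X \<and>
           normally_aperiodic G X"
  shows "decidable_word_problem p G \<phi>"
proof -
  interpret marked_group G p \<phi>
    using assms(1,2) by (simp add: marked_group_def marked_group_axioms_def)
  from assms(4) obtain A :: "'a set" and X where A: "finite A"
    and X: "effectively_closed p G \<phi> A X" "normally_aperiodic G X" by blast
  from X(1) obtain L e where L: "L \<subseteq> patterns p A" "X = avoiding_configurations G \<phi> A L"
    and e: "inj_on e A" "recursively_enumerable (pattern_code e ` L)"
    unfolding effectively_closed_def recursively_enumerable_patterns_def by blast
  have "decidable (\<lambda>n. n \<in> relators)"
  proof (rule decidable_relators[OF _ A e(1) L(1)])
    show "semidecidable (\<lambda>n. n \<in> relators)"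
      using assms(3) unfolding recursively_presented_def by (rule semidecidable_recursively_enumerable)
    show "semidecidable (\<lambda>n. n \<in> pattern_code e ` L)"
      using e(2) by (rule semidecidable_recursively_enumerable)
    show "avoiding_configurations G \<phi> A L \<noteq> {}"
      using X(2) L(2) unfolding normally_aperiodic_def by blast
    show "finite (invariance_core G x)" if "x \<in> avoiding_configurations G \<phi> A L" for x
      using X(2) that L(2) finite_subset[OF invariance_core_subset[OF assms(1)]]
      unfolding normally_aperiodic_def by blast
  qed
  then show ?thesis
    unfolding decidable_word_problem_def recursive_def decidable_def computable_def of_bool_def .
qed

end
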